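(* The problem $\mathrm{PartSynth}(\mathrm{FO}^2[\sim,<])$ is undecidable; that is, there is no algorithm which, given a finite alphabet $A=A_S\uplus A_E$ of actions and a sentence $\varphi\in\mathrm{FO}^2[\sim,<]$ over $A$, decides whether there exist finite disjoint sets of processes $\mathbb{P}_S$ and $\mathbb{P}_E$ (with no shared processes) such that System has a winning strategy for $\varphi$.
   Context: **Data words.** $A$ is a finite alphabet of actions, partitioned into System actions $A_S$ and Environment actions $A_E$. Processes are partitioned between the players: $\mathbb{P}_S$ (System processes) and $\mathbb{P}_E$ (Environment processes) are disjoint finite sets, and there is no shared process. Let $\Sigma_S := A_S\times\mathbb{P}_S$, $\Sigma_E := A_E\times\mathbb{P}_E$, $\Sigma:=\Sigma_S\cup\Sigma_E$. A data word is a finite or infinite sequence $w=(a_0,p_0)(a_1,p_1)\cdots$ over $\Sigma$; each pair $(a_i,p_i)$ in the sequence is called a position. **Logic.** Formulas of $\mathrm{FO}^2[\sim,<]$ are first-order formulas (connectives $\neg,\land,\lor,\exists,\forall$) using only two (reusable) variables $x,y$, built from the atoms $a(x)$ for $a\in A$, $x=y$, $x<y$, $x\sim y$, $\mathbb{P}_S(x)$, $\mathbb{P}_E(x)$ (and $\mathbb{P}_{SE}(x)$, for shared processes, which is interpreted as the empty set here), up to renaming of the two variables; the successor relation is not available. A data word is represented as a structure whose domain has one element for each position and one element for each process in $\mathbb{P}_S\cup\mathbb{P}_E$ (including processes on which no action is played). $\mathbb{P}_S$ (resp. $\mathbb{P}_E$) is interpreted as the set of process elements of System (resp. Environment); $a$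 is interpreted as the set of positions whose action is $a$; $<$ is the linear order on positions; $\sim$ is the equivalence relation such that two positions $(a_i,p_i)$, $(a_j,p_j)$ are related iff $p_i=p_j$, and each process element $p$ is related to all positions of the form $(a,p)$. **Strategies.** A strategy for System is a function $\mathcal{S}:\Sigma^*\to\Sigma_S\cup\{\varepsilon\}$. An execution (data word) $w=\sigma_0\sigma_1\cdots$ is $\mathcal{S}$-compatible if (i) for all $0\le i<|w|$, $\sigma_i\in\Sigma_S$ implies $\sigma_i=\mathcal{S}(\sigma_0\cdots\sigma_{i-1})$, and (ii) if $w$ is finite then $\mathcal{S}(w)=\varepsilon$. It is fair for $\mathcal{S}$ if, whenever there are infinitely many $i$ with $\mathcal{S}(\sigma_0\cdots\sigma_{i-1})\neq\varepsilon$, there are infinitely many positions of $w$ in $\Sigma_S$. $\mathcal{S}$ is winning for $\varphi$ if all executions that are $\mathcal{S}$-compatible and fair for $\mathcal{S}$ satisfy $\varphi$. **Problem.** For a logic $\mathcal{L}$, $\mathrm{PartSynth}(\mathcal{L})$ is the problem: given $A=A_S\uplus A_E$ and a sentence $\varphi\in\mathcal{L}$, decide whether System has a winning strategy for $\varphi$ for some arbitrary finite sets $\mathbb{P}_S$ and $\mathbb{P}_E$ (no shared processes). *)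

theory Defs
  imports Main "HOL-Library.Nat_Bijection"
begin

section \<open>Partial recursive functions\<close>

text \<open>Kleene's partial recursive functions, given by descriptions and the graph of the partial
  function each description denotes. A description that is applied to an argument list of the
  wrong length may fail to return a value.\<close>

datatype recf =
    Zero
  | Succ
  | Proj nat
  | Comp recf "recf list"
  | PrimRec recf recf
  | Mu recf

inductive rec_eval :: "recf \<Rightarrow> nat list \<Rightarrow> nat \<Rightarrow> bool" where
  Zero: "rec_eval Zero xs 0"
| Succ: "rec_eval Succ [x] (Suc x)"
| Proj: "i < length xs \<Longrightarrow> rec_eval (Proj i) xs (xs ! i)"
| Comp: "list_all2 (\<lambda>g y. rec_eval g xs y) gs ys \<Longrightarrow> rec_eval f ys z
    \<Longrightarrow> rec_eval (Comp f gs) xs z"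
| PrimRec_0: "rec_eval f xs y \<Longrightarrow> rec_eval (PrimRec f g) (0 # xs) y"
| PrimRec_Suc: "rec_eval (PrimRec f g) (n # xs) y \<Longrightarrow> rec_eval g (n # y # xs) z
    \<Longrightarrow> rec_eval (PrimRec f g) (Suc n # xs) z"
| Mu: "rec_eval f (n # xs) 0 \<Longrightarrow> (\<And>m. m < n \<Longrightarrow> \<exists>y. rec_eval f (m # xs) (Suc y))
    \<Longrightarrow> rec_eval (Mu f) xs n"

lemma rec_eval_deterministic:
  "rec_eval f xs y \<Longrightarrow> rec_eval f xs z \<Longrightarrow> y = z"
proof (induction arbitrary: z rule: rec_eval.induct)
  case (Zero xs)
  then show ?case by cases simp
next
  case (Succ x)
  then show ?case by cases simp
next
  case (Proj i xs)
  from Proj.prems show ?case by cases simp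
next
  case (Comp xs gs ys f z')
  from Comp.prems obtain ys' where
    ys': "list_all2 (\<lambda>g y. rec_eval g xs y) gs ys'" "rec_eval f ys' z"
    by cases simp
  have "ys = ys'"
    using Comp.IH(1) ys'(1) by (auto simp: list_all2_conv_all_nth intro!: nth_equalityI)
  then show ?case using Comp.IH(2) ys'(2) by simp
next
  case (PrimRec_0 f xs y g)
  from PrimRec_0.prems have "rec_eval f xs z" by cases simp
  with PrimRec_0.IH show ?case by blast
next
  case (PrimRec_Suc f g n xs y z')
  from PrimRec_Suc.prems obtain y' where
    "rec_eval (PrimRec f g) (n # xs) y'" "rec_eval g (n # y' # xs) z"
    by cases simp
  with PrimRec_Suc.IH show ?case by blast
next
  case (Mu f n xs)
  from Mu.prems have z: "rec_eval f (z # xs) 0"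
    "\<And>m. m < z \<Longrightarrow> \<exists>y. rec_eval f (m # xs) (Suc y)"
    by (cases, simp)+
  have "\<not> n < z"
  proof
    assume "n < z"
    from z(2)[OF this] obtain y where "rec_eval f (n # xs) (Suc y)" ..
    from Mu.IH(1)[OF this] show False by simp
  qed
  moreover have "\<not> z < n"
  proof
    assume "z < n"
    from Mu.IH(2)[OF this] obtain y where "\<forall>z'. rec_eval f (z # xs) z' \<longrightarrow> Suc y = z'" by blast
    with z(1) show False by blast
  qed
  ultimately show ?case by simp
qed

text \<open>A problem consists of the set of its instances, their representation as natural numbers and
  the instances with answer ``yes''. An algorithm deciding it has to halt with the right answer on
  all instances; its behaviour on numbers that represent no instance is irrelevant.\<close>

definition decidable_problem :: "'i set \<Rightarrow> ('i \<Rightarrow> nat) \<Rightarrow> ('i \<Rightarrow> bool) \<Rightarrow> bool" where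
  "decidable_problem I enc P \<longleftrightarrow>
    (\<exists>f. \<forall>i\<in>I. rec_eval f [enc i] (if P i then 1 else 0))"


section \<open>Data words\<close>

text \<open>Actions and processes are named by natural numbers. All alphabets and process sets are
  finite, so this is no restriction.\<close>

type_synonym action = nat
type_synonym proc = nat
type_synonym letter = "action \<times> proc"

datatype dword = Fin "letter list" | Inf "nat \<Rightarrow> letter"

fun positions :: "dword \<Rightarrow> nat set" where
  "positions (Fin u) = {..<length u}"
| "positions (Inf f) = UNIV"

fun letter_at :: "dword \<Rightarrow> nat \<Rightarrow> letter" where
  "letter_at (Fin u) i = u ! i"
| "letter_at (Inf f) i = f i"

text \<open>The lengths of the finite prefixes; unlike \<^const>\<open>positions\<close>, this includes the length of a
  finite word itself.\<close>

fun prefix_lengths :: "dword \<Rightarrow> nat set" where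
  "prefix_lengths (Fin u) = {..length u}"
| "prefix_lengths (Inf f) = UNIV"

definition prefix_of :: "dword \<Rightarrow> nat \<Rightarrow> letter list" where
  "prefix_of w n = map (letter_at w) [0..<n]"

definition dword_over :: "letter set \<Rightarrow> dword \<Rightarrow> bool" where
  "dword_over \<Sigma> w \<longleftrightarrow> (\<forall>i\<in>positions w. letter_at w i \<in> \<Sigma>)"


section \<open>The logic\<close>

datatype var = VX | VY

datatype form =
    Act action var
  | Eq var var
  | Less var var
  | Sim var var
  | IsS var
  | IsE var
  | IsSE var
  | Neg form
  | And form form
  | Or form form
  | Ex var form
  | All var form

primrec free_vars :: "form \<Rightarrow> var set" where
  "free_vars (Act a u) = {u}"
| "free_vars (Eq u v) = {u, v}"
| "free_vars (Less u v) = {u, v}"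
| "free_vars (Sim u v) = {u, v}"
| "free_vars (IsS u) = {u}"
| "free_vars (IsE u) = {u}"
| "free_vars (IsSE u) = {u}"
| "free_vars (Neg \<phi>) = free_vars \<phi>"
| "free_vars (And \<phi> \<psi>) = free_vars \<phi> \<union> free_vars \<psi>"
| "free_vars (Or \<phi> \<psi>) = free_vars \<phi> \<union> free_vars \<psi>"
| "free_vars (Ex u \<phi>) = free_vars \<phi> - {u}"
| "free_vars (All u \<phi>) = free_vars \<phi> - {u}"

primrec actions :: "form \<Rightarrow> action set" where
  "actions (Act a u) = {a}"
| "actions (Eq u v) = {}"
| "actions (Less u v) = {}"
| "actions (Sim u v) = {}"
| "actions (IsS u) = {}"
| "actions (IsE u) = {}"
| "actions (IsSE u) = {}"
| "actions (Neg \<phi>) = actions \<phi>"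
| "actions (And \<phi> \<psi>) = actions \<phi> \<union> actions \<psi>"
| "actions (Or \<phi> \<psi>) = actions \<phi> \<union> actions \<psi>"
| "actions (Ex u \<phi>) = actions \<phi>"
| "actions (All u \<phi>) = actions \<phi>"

datatype elem = Position nat | Process proc

definition domain :: "proc set \<Rightarrow> proc set \<Rightarrow> dword \<Rightarrow> elem set" where
  "domain PS PE w = Position ` positions w \<union> Process ` (PS \<union> PE)"

text \<open>Two elements are related by the equivalence relation of the structure iff they have the same
  owner.\<close>

primrec owner :: "dword \<Rightarrow> elem \<Rightarrow> proc" where
  "owner w (Position i) = snd (letter_at w i)"
| "owner w (Process p) = p"

primrec sat :: "proc set \<Rightarrow> proc set \<Rightarrow> dword \<Rightarrow> (var \<Rightarrow> elem) \<Rightarrow> form \<Rightarrow> bool" where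
  "sat PS PE w s (Act a u) \<longleftrightarrow> (\<exists>i. s u = Position i \<and> fst (letter_at w i) = a)"
| "sat PS PE w s (Eq u v) \<longleftrightarrow> s u = s v"
| "sat PS PE w s (Less u v) \<longleftrightarrow> (\<exists>i j. s u = Position i \<and> s v = Position j \<and> i < j)"
| "sat PS PE w s (Sim u v) \<longleftrightarrow> owner w (s u) = owner w (s v)"
| "sat PS PE w s (IsS u) \<longleftrightarrow> s u \<in> Process ` PS"
| "sat PS PE w s (IsE u) \<longleftrightarrow> s u \<in> Process ` PE"
| "sat PS PE w s (IsSE u) \<longleftrightarrow> False"
| "sat PS PE w s (Neg \<phi>) \<longleftrightarrow> \<not> sat PS PE w s \<phi>"
| "sat PS PE w s (And \<phi> \<psi>) \<longleftrightarrow> sat PS PE w s \<phi> \<and> sat PS PE w s \<psi>"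
| "sat PS PE w s (Or \<phi> \<psi>) \<longleftrightarrow> sat PS PE w s \<phi> \<or> sat PS PE w s \<psi>"
| "sat PS PE w s (Ex u \<phi>) \<longleftrightarrow> (\<exists>e\<in>domain PS PE w. sat PS PE w (s(u := e)) \<phi>)"
| "sat PS PE w s (All u \<phi>) \<longleftrightarrow> (\<forall>e\<in>domain PS PE w. sat PS PE w (s(u := e)) \<phi>)"

text \<open>Only used for sentences, whose truth value does not depend on the assignment. The domain is
  empty for the empty word without processes, so assignments are not confined to it.\<close>

definition models :: "proc set \<Rightarrow> proc set \<Rightarrow> dword \<Rightarrow> form \<Rightarrow> bool" where
  "models PS PE w \<phi> \<longleftrightarrow> (\<forall>s. sat PS PE w s \<phi>)"


section \<open>Strategies\<close>

text \<open>The value \<^const>\<open>None\<close> plays the role of \<open>\<epsilon>\<close>.\<close>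

type_synonym strategy = "letter list \<Rightarrow> letter option"

definition is_strategy :: "letter set \<Rightarrow> letter set \<Rightarrow> strategy \<Rightarrow> bool" where
  "is_strategy \<Sigma>S \<Sigma>E \<S> \<longleftrightarrow> (\<forall>u\<in>lists (\<Sigma>S \<union> \<Sigma>E). \<forall>\<sigma>. \<S> u = Some \<sigma> \<longrightarrow> \<sigma> \<in> \<Sigma>S)"

definition compatible :: "letter set \<Rightarrow> strategy \<Rightarrow> dword \<Rightarrow> bool" where
  "compatible \<Sigma>S \<S> w \<longleftrightarrow>
    (\<forall>i\<in>positions w. letter_at w i \<in> \<Sigma>S \<longrightarrow> \<S> (prefix_of w i) = Some (letter_at w i)) \<and>
    (\<forall>u. w = Fin u \<longrightarrow> \<S> u = None)"

definition fair :: "letter set \<Rightarrow> strategy \<Rightarrow> dword \<Rightarrow> bool" where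
  "fair \<Sigma>S \<S> w \<longleftrightarrow>
    (infinite {i \<in> prefix_lengths w. \<S> (prefix_of w i) \<noteq> None} \<longrightarrow>
     infinite {i \<in> positions w. letter_at w i \<in> \<Sigma>S})"

definition winning ::
  "action set \<Rightarrow> action set \<Rightarrow> proc set \<Rightarrow> proc set \<Rightarrow> strategy \<Rightarrow> form \<Rightarrow> bool" where
  "winning AS AE PS PE \<S> \<phi> \<longleftrightarrow>
    (\<forall>w. dword_over (AS \<times> PS \<union> AE \<times> PE) w \<longrightarrow> compatible (AS \<times> PS) \<S> w \<longrightarrow>
         fair (AS \<times> PS) \<S> w \<longrightarrow> models PS PE w \<phi>)"


section \<open>The synthesis problem\<close>

type_synonym inst = "action set \<times> action set \<times> form"

definition partsynth_instances :: "inst set" where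
  "partsynth_instances = {(AS, AE, \<phi>). finite AS \<and> finite AE \<and> AS \<inter> AE = {} \<and>
     free_vars \<phi> = {} \<and> actions \<phi> \<subseteq> AS \<union> AE}"

fun partsynth :: "inst \<Rightarrow> bool" where
  "partsynth (AS, AE, \<phi>) \<longleftrightarrow>
    (\<exists>PS PE. finite PS \<and> finite PE \<and> PS \<inter> PE = {} \<and>
      (\<exists>\<S>. is_strategy (AS \<times> PS) (AE \<times> PE) \<S> \<and> winning AS AE PS PE \<S> \<phi>))"

primrec var_encode :: "var \<Rightarrow> nat" where
  "var_encode VX = 0"
| "var_encode VY = 1"

primrec form_encode :: "form \<Rightarrow> nat" where
  "form_encode (Act a u) = prod_encode (0, prod_encode (a, var_encode u))"
| "form_encode (Eq u v) = prod_encode (1, prod_encode (var_encode u, var_encode v))"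
| "form_encode (Less u v) = prod_encode (2, prod_encode (var_encode u, var_encode v))"
| "form_encode (Sim u v) = prod_encode (3, prod_encode (var_encode u, var_encode v))"
| "form_encode (IsS u) = prod_encode (4, var_encode u)"
| "form_encode (IsE u) = prod_encode (5, var_encode u)"
| "form_encode (IsSE u) = prod_encode (6, var_encode u)"
| "form_encode (Neg \<phi>) = prod_encode (7, form_encode \<phi>)"
| "form_encode (And \<phi> \<psi>) = prod_encode (8, prod_encode (form_encode \<phi>, form_encode \<psi>))"
| "form_encode (Or \<phi> \<psi>) = prod_encode (9, prod_encode (form_encode \<phi>, form_encode \<psi>))"
| "form_encode (Ex u \<phi>) = prod_encode (10, prod_encode (var_encode u, form_encode \<phi>))"
| "form_encode (All u \<phi>) = prod_encode (11, prod_encode (var_encode u, form_encode \<phi>))"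

fun inst_encode :: "inst \<Rightarrow> nat" where
  "inst_encode (AS, AE, \<phi>) =
    prod_encode (set_encode AS, prod_encode (set_encode AE, form_encode \<phi>))"

lemma var_encode_eq_iff [simp]: "var_encode u = var_encode v \<longleftrightarrow> u = v"
  by (cases u; cases v) auto

lemma form_encode_eq_iff [simp]: "form_encode \<phi> = form_encode \<psi> \<longleftrightarrow> \<phi> = \<psi>"
  by (induction \<phi> arbitrary: \<psi>; case_tac \<psi>; simp)

lemma inj_on_inst_encode: "inj_on inst_encode partsynth_instances"
  by (auto simp: inj_on_def partsynth_instances_def set_encode_eq)

end

theory Submission
  imports Defs "HOL-Library.Countable"
begin

text \<open>System plays a run of a nondeterministic counter program, one process per increment: the value
  of a register is the number of processes that have incremented but not yet decremented it.
  Environment has a single action, a challenge. The first challenge marks a point of the word, and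
  relative to that point two variables suffice to express that the last move before it was
  legal: the labels of the last two moves are definable, and so are the processes with a pending
  increment. As Environment may challenge after any move, a winning strategy must play a
  correct run throughout, and it has to reach the accepting state if there is no challenge.

  Neither a universal machine nor a recursion theorem is needed. The input of the program is a pair of
  numbers that the formula fixes by counting positions. Given a decision procedure, the program
  that runs it on the instance assembled from its input \<open>(x, y)\<close>, and accepts if the answer is
  ``no'', is a contradiction when \<open>x\<close> and \<open>y\<close> are the codes of its own alphabet and formula.\<close>


section \<open>Computability of the encoding\<close>

text \<open>With two variables and no successor relation, there is no direct way to compare every
  move with the one before it; only the end of a definable prefix is within reach. The game turns
  this single check into a check of all moves, because a strategy commits to its move before it
  knows whether a challenge follows.

  Nondeterminism of the programs costs nothing, as System resolves it: a loop guesses how often to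
  iterate, and a decrement or zero test after a wrong guess has no legal continuation. The number of
  processes is not bounded in advance, but an accepting run is finite, so some finite set suffices
  exactly if such a run exists.

  The input stays outside the automaton to avoid circularity. The alphabet and \<open>spec E\<close>
  depend on the automaton alone, so their codes \<open>x\<close> and \<open>y\<close> may be taken
  afterwards; the remaining conjunct \<open>on_input x y\<close> is computed by the program itself
  from \<open>x\<close> and \<open>y\<close>.\<close>

definition computable :: "nat \<Rightarrow> (nat list \<Rightarrow> nat) \<Rightarrow> bool" where
  "computable n h \<longleftrightarrow> (\<exists>f. \<forall>xs. length xs = n \<longrightarrow> rec_eval f xs (h xs))"

lemma computable_proj: "i < n \<Longrightarrow> computable n (\<lambda>xs. xs ! i)"
  unfolding computable_def by (auto intro: rec_eval.Proj)

lemma computable_Suc: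
  assumes "computable n h"
  shows "computable n (\<lambda>xs. Suc (h xs))"
proof -
  obtain f where "\<forall>xs. length xs = n \<longrightarrow> rec_eval f xs (h xs)"
    using assms unfolding computable_def by blast
  then have "\<forall>xs. length xs = n \<longrightarrow> rec_eval (Comp recf.Succ [f]) xs (Suc (h xs))"
    by (auto intro!: rec_eval.Comp[where ys = "[_]"] rec_eval.Succ)
  then show ?thesis unfolding computable_def by blast
qed

lemma computable_const: "computable n (\<lambda>_. k)"
proof (induction k)
  case 0
  show ?case unfolding computable_def using rec_eval.Zero by blast
next
  case (Suc k)
  then show ?case by (rule computable_Suc)
qed

lemma computable_comp2:
  assumes "computable 2 h" "computable n a" "computable n b"
  shows "computable n (\<lambda>xs. h [a xs, b xs])"
proof -
  obtain f g1 g2 where "\<forall>xs. length xs = 2 \<longrightarrow> rec_eval f xs (h xs)"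
    "\<forall>xs. length xs = n \<longrightarrow> rec_eval g1 xs (a xs)" "\<forall>xs. length xs = n \<longrightarrow> rec_eval g2 xs (b xs)"
    using assms unfolding computable_def by blast
  then have "\<forall>xs. length xs = n \<longrightarrow> rec_eval (Comp f [g1, g2]) xs (h [a xs, b xs])"
    by (auto intro!: rec_eval.Comp[where ys = "[_, _]"])
  then show ?thesis unfolding computable_def by blast
qed

lemma computable_comp1:
  assumes "computable 1 h" "computable n a"
  shows "computable n (\<lambda>xs. h [a xs])"
proof -
  obtain f g where "\<forall>xs. length xs = 1 \<longrightarrow> rec_eval f xs (h xs)"
    "\<forall>xs. length xs = n \<longrightarrow> rec_eval g xs (a xs)"
    using assms unfolding computable_def by blast
  then have "\<forall>xs. length xs = n \<longrightarrow> rec_eval (Comp f [g]) xs (h [a xs])"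
    by (auto intro!: rec_eval.Comp[where ys = "[_]"])
  then show ?thesis unfolding computable_def by blast
qed

lemma computable_rec_nat:
  assumes "computable n a" "computable (Suc (Suc n)) b"
  shows "computable (Suc n) (\<lambda>xs. rec_nat (a (tl xs)) (\<lambda>k y. b (k # y # tl xs)) (hd xs))"
proof -
  obtain f g where f: "\<forall>xs. length xs = n \<longrightarrow> rec_eval f xs (a xs)"
    and g: "\<forall>xs. length xs = Suc (Suc n) \<longrightarrow> rec_eval g xs (b xs)"
    using assms unfolding computable_def by blast
  have "rec_eval (PrimRec f g) (k # xs) (rec_nat (a xs) (\<lambda>k y. b (k # y # xs)) k)"
    if "length xs = n" for k xs
    by (induction k) (use f g that in \<open>auto intro: rec_eval.intros\<close>)
  then have "\<forall>xs. length xs = Suc n \<longrightarrow>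
      rec_eval (PrimRec f g) xs (rec_nat (a (tl xs)) (\<lambda>k y. b (k # y # tl xs)) (hd xs))"
    by (auto simp: length_Suc_conv)
  then show ?thesis unfolding computable_def by blast
qed

lemma computable_add:
  assumes "computable n a" "computable n b"
  shows "computable n (\<lambda>xs. a xs + b xs)"
proof -
  have "computable (Suc 1) (\<lambda>xs. rec_nat (tl xs ! 0) (\<lambda>k y. Suc ((k # y # tl xs) ! 1)) (hd xs))"
    by (rule computable_rec_nat) (intro computable_Suc computable_proj; simp)+
  moreover have "rec_nat c (\<lambda>k y. Suc ((k # y # cs) ! 1)) m = m + c" for c m and cs :: "nat list"
    by (induction m) auto
  ultimately have "computable 2 (\<lambda>xs. hd xs + tl xs ! 0)" by (simp add: numeral_2_eq_2)
  from computable_comp2[OF this assms] show ?thesis by simp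
qed

lemma computable_triangle:
  assumes "computable n a"
  shows "computable n (\<lambda>xs. triangle (a xs))"
proof -
  have "computable (Suc 0)
      (\<lambda>xs. rec_nat 0 (\<lambda>k y. (k # y # tl xs) ! 1 + Suc ((k # y # tl xs) ! 0)) (hd xs))"
    by (rule computable_rec_nat)
      (intro computable_const computable_add computable_Suc computable_proj; simp)+
  moreover have "rec_nat 0 (\<lambda>k y. (k # y # cs) ! 1 + Suc ((k # y # cs) ! 0)) m = triangle m"
    for m and cs :: "nat list"
    by (induction m) auto
  ultimately have "computable 1 (\<lambda>xs. triangle (hd xs))" by simp
  from computable_comp1[OF this assms] show ?thesis by simp
qed

text \<open>Pairing has to be computed but never inverted: the codes of the alphabet and of the
  formula arrive as numbers and are only embedded into larger pairs.\<close>

lemma computable_prod_encode: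
  assumes "computable n a" "computable n b"
  shows "computable n (\<lambda>xs. prod_encode (a xs, b xs))"
  unfolding prod_encode_def split_conv
  by (intro computable_add computable_triangle assms)


section \<open>Nondeterministic counter programs\<close>

datatype op = Inc nat | Dec nat | Test nat | Nop

type_synonym store = "nat \<Rightarrow> nat"

primrec op_step :: "op \<Rightarrow> store \<Rightarrow> store \<Rightarrow> bool" where
  "op_step (Inc r) \<sigma> \<sigma>' \<longleftrightarrow> \<sigma>' = \<sigma>(r := Suc (\<sigma> r))"
| "op_step (Dec r) \<sigma> \<sigma>' \<longleftrightarrow> 0 < \<sigma> r \<and> \<sigma>' = \<sigma>(r := \<sigma> r - 1)"
| "op_step (Test r) \<sigma> \<sigma>' \<longleftrightarrow> \<sigma> r = 0 \<and> \<sigma>' = \<sigma>"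
| "op_step Nop \<sigma> \<sigma>' \<longleftrightarrow> \<sigma>' = \<sigma>"

text \<open>\<open>Loop\<close> is the only source of nondeterminism. In the programs below a wrong
  number of rounds runs into a blocked \<open>Dec\<close> or \<open>Test\<close> and so contributes
  no pair of stores to \<open>sem\<close>.\<close>

datatype prog = Op op | Seq prog prog | Loop prog

primrec sem :: "prog \<Rightarrow> store \<Rightarrow> store \<Rightarrow> bool" where
  "sem (Op a) = op_step a"
| "sem (Seq p q) = sem p OO sem q"
| "sem (Loop p) = (sem p)\<^sup>*\<^sup>*"

declare sem.simps(2) [simp del]

lemma sem_Seq [simp]: "sem (Seq p q) \<sigma> \<sigma>' \<longleftrightarrow> (\<exists>\<tau>. sem p \<sigma> \<tau> \<and> sem q \<tau> \<sigma>')"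
  by (auto simp: sem.simps(2))

section \<open>Program macros for blocking, moving, clearing and copying\<close>

primrec seqs :: "prog list \<Rightarrow> prog" where
  "seqs [] = Op Nop"
| "seqs (p # ps) = Seq p (seqs ps)"

text \<open>A program with no final store, used where the argument list has a length for which
  \<open>rec_eval\<close> yields no value.\<close>

definition fail :: prog where
  "fail = Seq (Op (Inc 0)) (Op (Test 0))"

lemma sem_fail [simp]: "\<not> sem fail \<sigma> \<sigma>'"
  by (auto simp: fail_def)

definition drain :: "nat \<Rightarrow> nat list \<Rightarrow> prog" where
  "drain a rs = Seq (Loop (Seq (Op (Dec a)) (seqs (map (\<lambda>r. Op (Inc r)) rs)))) (Op (Test a))"

lemma sem_incs:
  "distinct rs \<Longrightarrow> sem (seqs (map (\<lambda>r. Op (Inc r)) rs)) \<sigma> \<sigma>' \<longleftrightarrow>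
    \<sigma>' = (\<lambda>r. if r \<in> set rs then Suc (\<sigma> r) else \<sigma> r)"
proof (induction rs arbitrary: \<sigma>)
  case (Cons a rs)
  then have "(\<lambda>r. if r \<in> set rs then Suc ((\<sigma>(a := Suc (\<sigma> a))) r) else (\<sigma>(a := Suc (\<sigma> a))) r) =
      (\<lambda>r. if r \<in> set (a # rs) then Suc (\<sigma> r) else \<sigma> r)"
    by auto
  with Cons show ?case by simp
qed simp

text \<open>After k rounds exactly k units have left \<open>a\<close>, with k at most its content.
  The closing test leaves only k = \<open>\<sigma> a\<close>, which makes the guessed loop
  deterministic.\<close>

lemma sem_drain:
  assumes "distinct rs" "a \<notin> set rs"
  shows "sem (drain a rs) \<sigma> \<sigma>' \<longleftrightarrow>
    \<sigma>' = (\<lambda>r. if r = a then 0 else if r \<in> set rs then \<sigma> r + \<sigma> a else \<sigma> r)"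
proof -
  let ?inc = "\<lambda>k \<sigma> r. if r = a then \<sigma> a - k else if r \<in> set rs then \<sigma> r + k else \<sigma> r :: nat"
  let ?p = "Seq (Op (Dec a)) (seqs (map (\<lambda>r. Op (Inc r)) rs))"
  have p: "sem ?p \<sigma> \<sigma>' \<longleftrightarrow> 0 < \<sigma> a \<and> \<sigma>' = ?inc 1 \<sigma>" for \<sigma> \<sigma>'
  proof -
    let ?\<tau> = "\<sigma>(a := \<sigma> a - 1)"
    have "(\<lambda>r. if r \<in> set rs then Suc (?\<tau> r) else ?\<tau> r) = ?inc 1 \<sigma>"
      using assms by auto
    then show ?thesis by (simp add: sem_incs[OF assms(1)] del: One_nat_def)
  qed
  have reach: "\<exists>k\<le>\<sigma> a. \<sigma>' = ?inc k \<sigma>" if "(sem ?p)\<^sup>*\<^sup>* \<sigma> \<sigma>'" for \<sigma>'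
    using that
  proof induction
    case base
    show ?case by (intro exI[of _ 0]) (auto simp: fun_eq_iff)
  next
    case (step \<tau> \<tau>')
    then obtain k where k: "k \<le> \<sigma> a" "\<tau> = ?inc k \<sigma>" by blast
    moreover have "0 < \<tau> a" "\<tau>' = ?inc 1 \<tau>" using step(2) unfolding p by blast+
    ultimately show ?case
      by (intro exI[of _ "Suc k"]) (auto simp: fun_eq_iff assms)
  qed
  have conv: "(sem ?p)\<^sup>*\<^sup>* \<sigma> (?inc k \<sigma>)" if "k \<le> \<sigma> a" for k
    using that
  proof (induction k)
    case 0
    have "?inc 0 \<sigma> = \<sigma>" by auto
    then show ?case by simp
  next
    case (Suc k)
    have "sem ?p (?inc k \<sigma>) (?inc (Suc k) \<sigma>)"
      unfolding p using Suc.prems by (auto simp: fun_eq_iff)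
    with Suc show ?case by (meson Suc_leD rtranclp.rtrancl_into_rtrancl)
  qed
  have drained: "?inc (\<sigma> a) \<sigma> = (\<lambda>r. if r = a then 0 else if r \<in> set rs then \<sigma> r + \<sigma> a else \<sigma> r)"
    by auto
  have "sem (drain a rs) \<sigma> \<sigma>' \<longleftrightarrow> (sem ?p)\<^sup>*\<^sup>* \<sigma> \<sigma>' \<and> \<sigma>' a = 0"
    by (auto simp: drain_def)
  also have "\<dots> \<longleftrightarrow> \<sigma>' = ?inc (\<sigma> a) \<sigma>"
  proof
    assume *: "(sem ?p)\<^sup>*\<^sup>* \<sigma> \<sigma>' \<and> \<sigma>' a = 0"
    then obtain k where "k \<le> \<sigma> a" "\<sigma>' = ?inc k \<sigma>" using reach by blast
    moreover from this * have "k = \<sigma> a" by simp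
    ultimately show "\<sigma>' = ?inc (\<sigma> a) \<sigma>" by (simp only:)
  next
    assume "\<sigma>' = ?inc (\<sigma> a) \<sigma>"
    then show "(sem ?p)\<^sup>*\<^sup>* \<sigma> \<sigma>' \<and> \<sigma>' a = 0" using conv[of "\<sigma> a"] by simp
  qed
  finally show ?thesis unfolding drained .
qed

definition clear :: "nat \<Rightarrow> prog" where
  "clear r = drain r []"

lemma sem_clear [simp]: "sem (clear r) \<sigma> \<sigma>' \<longleftrightarrow> \<sigma>' = \<sigma>(r := 0)"
  by (auto simp: clear_def sem_drain fun_eq_iff)

text \<open>Reading a register destroys it, so \<open>a\<close> is drained into \<open>b\<close> and
  \<open>t\<close> at once and then restored from \<open>t\<close>.\<close>

definition copy :: "nat \<Rightarrow> nat \<Rightarrow> nat \<Rightarrow> prog" where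
  "copy a b t = seqs [clear b, drain a [b, t], drain t [a]]"

lemma sem_copy:
  assumes "a \<noteq> b" "a \<noteq> t" "b \<noteq> t" "\<sigma> t = 0"
  shows "sem (copy a b t) \<sigma> \<sigma>' \<longleftrightarrow> \<sigma>' = \<sigma>(b := \<sigma> a)"
proof -
  have "sem (copy a b t) \<sigma> \<sigma>' \<longleftrightarrow> \<sigma>' = \<sigma>(b := \<sigma> a, t := 0)"
    using assms by (simp add: copy_def sem_drain) (rule arg_cong[where f = "(=) \<sigma>'"], auto)
  also have "\<sigma>(b := \<sigma> a, t := 0) = \<sigma>(b := \<sigma> a)" using assms by auto
  finally show ?thesis .
qed

text \<open>The arguments are read from the registers \<open>rs\<close>, the result is written to \<open>d\<close>, and the
  registers from \<open>m\<close> on serve as scratch space, which is zero before and after.\<close>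

primrec compile :: "recf \<Rightarrow> nat list \<Rightarrow> nat \<Rightarrow> nat \<Rightarrow> prog" where
  "compile Zero = (\<lambda>rs d m. clear d)"
| "compile Succ = (\<lambda>rs d m. if length rs = 1 then Seq (copy (hd rs) d m) (Op (Inc d)) else fail)"
| "compile (Proj i) = (\<lambda>rs d m. if i < length rs then copy (rs ! i) d m else fail)"
| "compile (Comp f gs) = (\<lambda>rs d m. let k = length gs in
    seqs [seqs (map (\<lambda>(i, c). c rs (m + i) (m + k)) (enumerate 0 (map compile gs))),
      compile f [m..<m + k] d (m + k),
      seqs (map clear [m..<m + k])])"
| "compile (PrimRec f g) = (\<lambda>rs d m. if rs = [] then fail else
    seqs [copy (hd rs) (m + 2) (m + 4),
      compile f (tl rs) (m + 1) (m + 4),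
      Loop (seqs [Op (Dec (m + 2)), compile g (m # (m + 1) # tl rs) (m + 3) (m + 4),
        copy (m + 3) (m + 1) (m + 4), clear (m + 3), Op (Inc m)]),
      Op (Test (m + 2)), copy (m + 1) d (m + 4), clear m, clear (m + 1)])"
| "compile (Mu f) = (\<lambda>rs d m.
    seqs [Loop (seqs [compile f (m # rs) (m + 1) (m + 2), Op (Dec (m + 1)), clear (m + 1),
        Op (Inc m)]),
      compile f (m # rs) (m + 1) (m + 2), Op (Test (m + 1)), copy m d (m + 2), clear m])"

text \<open>An equivalence, because the reduction needs both directions: every value is reached by
  some execution, and no execution ends in any other store, in particular none if there is no
  value.\<close>

definition compiles :: "recf \<Rightarrow> bool" where
  "compiles f \<longleftrightarrow> (\<forall>rs d m \<sigma> \<sigma>'. set rs \<subseteq> {..<m} \<longrightarrow> d < m \<longrightarrow> d \<notin> set rs \<longrightarrow> (\<forall>r\<ge>m. \<sigma> r = 0) \<longrightarrow>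
    sem (compile f rs d m) \<sigma> \<sigma>' \<longleftrightarrow> (\<exists>y. rec_eval f (map \<sigma> rs) y \<and> \<sigma>' = \<sigma>(d := y)))"

lemma compilesD:
  assumes "compiles f" "set rs \<subseteq> {..<m}" "d < m" "d \<notin> set rs" "\<forall>r\<ge>m. \<sigma> r = 0"
  shows "sem (compile f rs d m) \<sigma> \<sigma>' \<longleftrightarrow> (\<exists>y. rec_eval f (map \<sigma> rs) y \<and> \<sigma>' = \<sigma>(d := y))"
  using assms unfolding compiles_def by blast

lemma rec_eval_Zero_iff [simp]: "rec_eval Zero xs y \<longleftrightarrow> y = 0"
  by (auto elim: rec_eval.cases intro: rec_eval.intros)

lemma rec_eval_Succ_iff [simp]: "rec_eval Succ xs y \<longleftrightarrow> (\<exists>x. xs = [x] \<and> y = Suc x)"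
  by (auto elim: rec_eval.cases intro: rec_eval.intros)

lemma rec_eval_Proj_iff [simp]: "rec_eval (Proj i) xs y \<longleftrightarrow> i < length xs \<and> y = xs ! i"
  by (auto elim: rec_eval.cases intro: rec_eval.intros)

lemma rec_eval_Comp_iff [simp]:
  "rec_eval (Comp f gs) xs z \<longleftrightarrow> (\<exists>ys. list_all2 (\<lambda>g y. rec_eval g xs y) gs ys \<and> rec_eval f ys z)"
  by (rule iffI, erule rec_eval.cases) (auto intro: rec_eval.intros)

lemma rec_eval_PrimRec_Nil [simp]: "\<not> rec_eval (PrimRec f g) [] z"
  by (auto elim: rec_eval.cases)

lemma rec_eval_PrimRec_0 [simp]: "rec_eval (PrimRec f g) (0 # xs) z \<longleftrightarrow> rec_eval f xs z"
  by (rule iffI, erule rec_eval.cases) (auto intro: rec_eval.intros)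

lemma rec_eval_PrimRec_Suc [simp]:
  "rec_eval (PrimRec f g) (Suc n # xs) z \<longleftrightarrow>
    (\<exists>y. rec_eval (PrimRec f g) (n # xs) y \<and> rec_eval g (n # y # xs) z)"
  by (rule iffI, erule rec_eval.cases) (auto intro: rec_eval.intros)

lemma rec_eval_Mu_iff [simp]:
  "rec_eval (Mu f) xs n \<longleftrightarrow>
    rec_eval f (n # xs) 0 \<and> (\<forall>m<n. \<exists>y. rec_eval f (m # xs) (Suc y))"
  by (rule iffI, erule rec_eval.cases) (auto intro: rec_eval.intros)

lemma sem_clears:
  "sem (seqs (map clear rs)) \<sigma> \<sigma>' \<longleftrightarrow> \<sigma>' = (\<lambda>r. if r \<in> set rs then 0 else \<sigma> r)"
proof (induction rs arbitrary: \<sigma>)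
  case (Cons a rs)
  have "(\<lambda>r. if r \<in> set rs then 0 else (\<sigma>(a := 0)) r) = (\<lambda>r. if r \<in> set (a # rs) then 0 else \<sigma> r)"
    by auto
  with Cons show ?case by simp
qed simp

text \<open>The offset \<open>j\<close> makes the induction on \<open>gs\<close> possible. Results
  are written above \<open>m\<close> and arguments are read below it, so earlier results do not
  disturb later evaluations.\<close>

lemma sem_compile_args:
  assumes "\<And>g. g \<in> set gs \<Longrightarrow> compiles g" "set rs \<subseteq> {..<m}" "j + length gs \<le> k"
    "\<forall>r\<ge>m + k. \<sigma> r = 0"
  shows "sem (seqs (map (\<lambda>(i, c). c rs (m + i) (m + k)) (enumerate j (map compile gs)))) \<sigma> \<sigma>' \<longleftrightarrow>
    (\<exists>ys. list_all2 (\<lambda>g y. rec_eval g (map \<sigma> rs) y) gs ys \<and>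
      \<sigma>' = (\<lambda>r. if m + j \<le> r \<and> r < m + j + length gs then ys ! (r - (m + j)) else \<sigma> r))"
  using assms
proof (induction gs arbitrary: j \<sigma>)
  case Nil
  then show ?case by (auto simp: fun_eq_iff)
next
  case (Cons g gs)
  have g: "sem (compile g rs (m + j) (m + k)) \<sigma> \<tau> \<longleftrightarrow>
      (\<exists>y. rec_eval g (map \<sigma> rs) y \<and> \<tau> = \<sigma>(m + j := y))" for \<tau>
    using Cons.prems by (intro compilesD) auto
  have m: "map (\<sigma>(m + j := y)) rs = map \<sigma> rs" for y
    using Cons.prems(2) by (auto simp: fun_upd_def)
  let ?c = "\<lambda>(i, c). c rs (m + i) (m + k)"
  let ?R = "list_all2 (\<lambda>g y. rec_eval g (map \<sigma> rs) y)"
  let ?\<tau> = "\<lambda>n ys r. if m + j \<le> r \<and> r < m + j + n then ys ! (r - (m + j)) else \<sigma> r"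
  have IH: "sem (seqs (map ?c (enumerate (Suc j) (map compile gs)))) (\<sigma>(m + j := y)) \<sigma>' \<longleftrightarrow>
      (\<exists>ys. ?R gs ys \<and> \<sigma>' = (\<lambda>r. if m + Suc j \<le> r \<and> r < m + Suc j + length gs
        then ys ! (r - (m + Suc j)) else (\<sigma>(m + j := y)) r))" for y
    by (rule Cons.IH[of "Suc j" "\<sigma>(m + j := y)", unfolded m]) (use Cons.prems in auto)
  have upd: "(\<lambda>r. if m + Suc j \<le> r \<and> r < m + Suc j + length gs then ys ! (r - (m + Suc j))
      else (\<sigma>(m + j := y)) r) = ?\<tau> (length (g # gs)) (y # ys)" for y and ys :: "nat list"
  proof
    fix r
    consider "r < m + j" | "r = m + j" | i where "r = m + j + Suc i"
      by (metis add_Suc_right less_natE linorder_neqE_nat)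
    then show "(if m + Suc j \<le> r \<and> r < m + Suc j + length gs then ys ! (r - (m + Suc j))
      else (\<sigma>(m + j := y)) r) = ?\<tau> (length (g # gs)) (y # ys) r"
      by cases auto
  qed
  have "sem (seqs (map ?c (enumerate j (map compile (g # gs))))) \<sigma> \<sigma>' \<longleftrightarrow>
      (\<exists>y. rec_eval g (map \<sigma> rs) y \<and>
        sem (seqs (map ?c (enumerate (Suc j) (map compile gs)))) (\<sigma>(m + j := y)) \<sigma>')"
    unfolding list.map enumerate_simps split_conv seqs.simps sem_Seq g by blast
  also have "\<dots> \<longleftrightarrow> (\<exists>y ys. rec_eval g (map \<sigma> rs) y \<and> ?R gs ys \<and>
      \<sigma>' = ?\<tau> (length (g # gs)) (y # ys))"
    unfolding IH upd by blast
  also have "\<dots> \<longleftrightarrow> (\<exists>ys. ?R (g # gs) ys \<and> \<sigma>' = ?\<tau> (length (g # gs)) ys)"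
    unfolding list_all2_Cons1 by blast
  finally show ?case .
qed

lemma compiles_Comp:
  assumes "compiles f" "\<And>g. g \<in> set gs \<Longrightarrow> compiles g"
  shows "compiles (Comp f gs)"
  unfolding compiles_def
proof (intro allI impI)
  fix rs d m and \<sigma> \<sigma>' :: store
  assume *: "set rs \<subseteq> {..<m}" "d < m" "d \<notin> set rs" "\<forall>r\<ge>m. \<sigma> r = 0"
  define k where "k = length gs"
  \<comment> \<open>The registers from \<open>m\<close> to \<open>m + k - 1\<close> hold the values
    of the inner functions, which serve as arguments of \<open>f\<close>; clearing them restores the
    zero scratch space.\<close>
  let ?\<tau> = "\<lambda>ys r. if m \<le> r \<and> r < m + k then ys ! (r - m) else \<sigma> r"
  have 1: "sem (seqs (map (\<lambda>(i, c). c rs (m + i) (m + k)) (enumerate 0 (map compile gs)))) \<sigma> \<tau> \<longleftrightarrow>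
      (\<exists>ys. list_all2 (\<lambda>g y. rec_eval g (map \<sigma> rs) y) gs ys \<and> \<tau> = ?\<tau> ys)" for \<tau>
    unfolding k_def by (rule sem_compile_args[of gs rs m 0 "length gs" \<sigma> \<tau>, unfolded add_0_right])
      (use assms(2) * in auto)
  have "map (?\<tau> ys) [m..<m + k] = ys" if "length ys = k" for ys
    by (rule nth_equalityI) (auto simp: that)
  then have 2: "sem (compile f [m..<m + k] d (m + k)) (?\<tau> ys) \<tau> \<longleftrightarrow>
      (\<exists>z. rec_eval f ys z \<and> \<tau> = (?\<tau> ys)(d := z))" if "length ys = k" for ys \<tau>
    using that * by (subst compilesD[OF assms(1)]) auto
  have 3: "(\<lambda>r. if r \<in> set [m..<m + k] then 0 else ((?\<tau> ys)(d := z)) r) = \<sigma>(d := z)" for ys z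
    using * by (auto simp: fun_eq_iff)
  have len: "length ys = k" if "list_all2 (\<lambda>g y. rec_eval g (map \<sigma> rs) y) gs ys" for ys
    using list_all2_lengthD[OF that] by (simp add: k_def)
  let ?R = "list_all2 (\<lambda>g y. rec_eval g (map \<sigma> rs) y) gs"
  have "sem (compile (Comp f gs) rs d m) \<sigma> \<sigma>' \<longleftrightarrow>
      (\<exists>ys. ?R ys \<and> (\<exists>\<tau>. sem (compile f [m..<m + k] d (m + k)) (?\<tau> ys) \<tau> \<and>
        \<sigma>' = (\<lambda>r. if r \<in> set [m..<m + k] then 0 else \<tau> r)))"
    unfolding compile.simps Let_def k_def[symmetric] seqs.simps sem_Seq 1 sem_clears sem.simps(1)
      op_step.simps by blast
  also have "\<dots> \<longleftrightarrow> (\<exists>ys. ?R ys \<and> (\<exists>z. rec_eval f ys z \<and>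
        \<sigma>' = (\<lambda>r. if r \<in> set [m..<m + k] then 0 else ((?\<tau> ys)(d := z)) r)))"
    by (intro ex_cong1 conj_cong refl) (auto simp: 2[OF len] simp del: set_upt fun_upd_apply)
  also have "\<dots> \<longleftrightarrow> (\<exists>y. rec_eval (Comp f gs) (map \<sigma> rs) y \<and> \<sigma>' = \<sigma>(d := y))"
    unfolding 3 rec_eval_Comp_iff by blast
  finally show "sem (compile (Comp f gs) rs d m) \<sigma> \<sigma>' \<longleftrightarrow>
      (\<exists>y. rec_eval (Comp f gs) (map \<sigma> rs) y \<and> \<sigma>' = \<sigma>(d := y))" .
qed

lemma compiles_PrimRec:
  assumes f: "compiles f" and g: "compiles g"
  shows "compiles (PrimRec f g)"
  unfolding compiles_def
proof (intro allI impI)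
  fix rs d m and \<sigma> \<sigma>' :: store
  assume *: "set rs \<subseteq> {..<m}" "d < m" "d \<notin> set rs" "\<forall>r\<ge>m. \<sigma> r = 0"
  show "sem (compile (PrimRec f g) rs d m) \<sigma> \<sigma>' \<longleftrightarrow>
      (\<exists>y. rec_eval (PrimRec f g) (map \<sigma> rs) y \<and> \<sigma>' = \<sigma>(d := y))"
  proof (cases rs)
    case Nil
    then show ?thesis by simp
  next
    case (Cons a as)
    let ?xs = "map \<sigma> as"
    \<comment> \<open>Register \<open>m\<close> counts the rounds done, \<open>m + 1\<close> holds
      the value of the recursion at that number, and \<open>m + 2\<close> the rounds left. The next
      value is produced in \<open>m + 3\<close>; scratch space begins at
      \<open>m + 4\<close>.\<close>
    let ?L = "\<lambda>n y k. \<sigma>(m := n, m + 1 := y, m + 2 := k)"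
    let ?B = "seqs [Op (Dec (m + 2)), compile g (m # (m + 1) # as) (m + 3) (m + 4),
        copy (m + 3) (m + 1) (m + 4), clear (m + 3), Op (Inc m)]"
    have as: "a < m" "set as \<subseteq> {..<m}" "d \<notin> set as" "d \<noteq> a" using * Cons by auto
    have low: "map \<tau> as = ?xs" if "\<forall>r<m. \<tau> r = \<sigma> r" for \<tau>
      using that as by auto
    have init: "sem (copy a (m + 2) (m + 4)) \<sigma> \<tau> \<longleftrightarrow> \<tau> = \<sigma>(m + 2 := \<sigma> a)" for \<tau>
      using as * by (subst sem_copy) auto
    have base: "sem (compile f as (m + 1) (m + 4)) (\<sigma>(m + 2 := \<sigma> a)) \<tau> \<longleftrightarrow>
        (\<exists>y. rec_eval f ?xs y \<and> \<tau> = ?L 0 y (\<sigma> a))" for \<tau>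
    proof -
      have "\<sigma>(m + 2 := \<sigma> a, m + 1 := y) = ?L 0 y (\<sigma> a)" for y
        using * by (auto simp: fun_eq_iff)
      moreover have "map (\<sigma>(m + 2 := \<sigma> a)) as = ?xs" by (rule low) auto
      moreover have "sem (compile f as (m + 1) (m + 4)) (\<sigma>(m + 2 := \<sigma> a)) \<tau> \<longleftrightarrow>
        (\<exists>y. rec_eval f (map (\<sigma>(m + 2 := \<sigma> a)) as) y \<and> \<tau> = \<sigma>(m + 2 := \<sigma> a, m + 1 := y))"
        using as * by (intro compilesD[OF f]) auto
      ultimately show ?thesis by (simp only:)
    qed
    have body: "sem ?B (?L n y k) \<tau> \<longleftrightarrow>
        0 < k \<and> (\<exists>z. rec_eval g (n # y # ?xs) z \<and> \<tau> = ?L (Suc n) z (k - 1))" for n y k \<tau>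
    proof -
      have dec: "(?L n y k)(m + 2 := k - 1) = ?L n y (k - 1)" by simp
      have "map (?L n y (k - 1)) (m # (m + 1) # as) = n # y # ?xs"
        using low[of "?L n y (k - 1)"] by simp
      moreover have "sem (compile g (m # (m + 1) # as) (m + 3) (m + 4)) (?L n y (k - 1)) \<tau> \<longleftrightarrow>
          (\<exists>z. rec_eval g (map (?L n y (k - 1)) (m # (m + 1) # as)) z \<and>
            \<tau> = (?L n y (k - 1))(m + 3 := z))" for \<tau>
        using as * by (intro compilesD[OF g]) auto
      ultimately have 1: "sem (compile g (m # (m + 1) # as) (m + 3) (m + 4)) (?L n y (k - 1)) \<tau> \<longleftrightarrow>
          (\<exists>z. rec_eval g (n # y # ?xs) z \<and> \<tau> = (?L n y (k - 1))(m + 3 := z))" for \<tau>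
        by (simp only:)
      have 2: "sem (copy (m + 3) (m + 1) (m + 4)) ((?L n y (k - 1))(m + 3 := z)) \<tau> \<longleftrightarrow>
          \<tau> = (?L n z (k - 1))(m + 3 := z)" for z \<tau>
        using * by (subst sem_copy) (auto simp: fun_eq_iff)
      have 3: "(?L n z (k - 1))(m + 3 := z, m + 3 := 0, m := Suc n) = ?L (Suc n) z (k - 1)"
        for z
        using * by (auto simp: fun_eq_iff)
      have 4: "((?L n z (k - 1))(m + 3 := z, m + 3 := 0)) m = n" for z by simp
      show ?thesis
        unfolding seqs.simps sem_Seq sem.simps(1) op_step.simps
        using 1 2 3 4 dec by (auto simp del: One_nat_def)
    qed
    have loop: "(sem ?B)\<^sup>*\<^sup>* (?L 0 y0 t) \<tau> \<longleftrightarrow>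
        (\<exists>n y. n \<le> t \<and> rec_eval (PrimRec f g) (n # ?xs) y \<and> \<tau> = ?L n y (t - n))"
      if y0: "rec_eval f ?xs y0" for y0 t \<tau>
    proof
      assume "(sem ?B)\<^sup>*\<^sup>* (?L 0 y0 t) \<tau>"
      then show "\<exists>n y. n \<le> t \<and> rec_eval (PrimRec f g) (n # ?xs) y \<and> \<tau> = ?L n y (t - n)"
      proof induction
        case base
        show ?case by (rule exI[of _ 0], rule exI[of _ y0]) (use y0 in \<open>simp add: fun_eq_iff\<close>)
      next
        case (step \<tau> \<tau>')
        then obtain n y where n: "n \<le> t" "rec_eval (PrimRec f g) (n # ?xs) y"
          "\<tau> = ?L n y (t - n)" by blast
        with step(2) obtain z where "0 < t - n" "rec_eval g (n # y # ?xs) z"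
          "\<tau>' = ?L (Suc n) z (t - n - 1)" unfolding n(3) body by auto
        with n show ?case
          by - (rule exI[of _ "Suc n"], rule exI[of _ z], auto)
      qed
    next
      have "(sem ?B)\<^sup>*\<^sup>* (?L 0 y0 t) (?L n y (t - n))"
        if "n \<le> t" "rec_eval (PrimRec f g) (n # ?xs) y" for n y
        using that
      proof (induction n arbitrary: y)
        case 0
        \<comment> \<open>The loop starts from one particular base value; determinism identifies it
          with the one underlying the given evaluation.\<close>
        then have "y = y0" using rec_eval_deterministic[OF y0] by simp
        then show ?case by simp
      next
        case (Suc n)
        then obtain y' where y': "rec_eval (PrimRec f g) (n # ?xs) y'"
          "rec_eval g (n # y' # ?xs) y" by auto
        have "sem ?B (?L n y' (t - n)) (?L (Suc n) y (t - Suc n))"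
          unfolding body using y' Suc.prems by auto
        with Suc.IH[OF _ y'(1)] Suc.prems show ?case
          by (meson Suc_leD rtranclp.rtrancl_into_rtrancl)
      qed
      then show "(sem ?B)\<^sup>*\<^sup>* (?L 0 y0 t) \<tau>"
        if "\<exists>n y. n \<le> t \<and> rec_eval (PrimRec f g) (n # ?xs) y \<and> \<tau> = ?L n y (t - n)"
        using that by blast
    qed
    have out: "sem (copy (m + 1) d (m + 4)) (?L n y 0) \<tau> \<longleftrightarrow> \<tau> = (?L n y 0)(d := y)" for n y \<tau>
      using * by (subst sem_copy) auto
    have fin: "(?L n y 0)(d := y, m := 0, m + 1 := 0) = \<sigma>(d := y)" for n y
      using * by (auto simp: fun_eq_iff)
    let ?T = "seqs [Op (Test (m + 2)), copy (m + 1) d (m + 4), clear m, clear (m + 1)]"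
    have tail: "sem ?T (?L n y k) \<sigma>' \<longleftrightarrow> k = 0 \<and> \<sigma>' = \<sigma>(d := y)" for n y k
    proof -
      have "?L n y k (m + 2) = k" by simp
      then have "sem ?T (?L n y k) \<sigma>' \<longleftrightarrow>
          k = 0 \<and> (\<exists>\<tau>. sem (copy (m + 1) d (m + 4)) (?L n y k) \<tau> \<and> \<sigma>' = \<tau>(m := 0, m + 1 := 0))"
        unfolding seqs.simps sem_Seq sem.simps(1) op_step.simps sem_clear by metis
      also have "\<dots> \<longleftrightarrow> k = 0 \<and> \<sigma>' = \<sigma>(d := y)"
        using out[of n y] fin[of n y] by metis
      finally show ?thesis .
    qed
    have prog: "compile (PrimRec f g) rs d m =
        Seq (copy a (m + 2) (m + 4)) (Seq (compile f as (m + 1) (m + 4)) (Seq (Loop ?B) ?T))"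
      by (simp add: Cons)
    have "sem (compile (PrimRec f g) rs d m) \<sigma> \<sigma>' \<longleftrightarrow>
        (\<exists>y0. rec_eval f ?xs y0 \<and> (\<exists>\<tau>. (sem ?B)\<^sup>*\<^sup>* (?L 0 y0 (\<sigma> a)) \<tau> \<and> sem ?T \<tau> \<sigma>'))"
      unfolding prog sem_Seq sem.simps(3) init simp_thms base by blast
    also have "\<dots> \<longleftrightarrow> (\<exists>y0. rec_eval f ?xs y0 \<and> (\<exists>n y. n \<le> \<sigma> a \<and>
        rec_eval (PrimRec f g) (n # ?xs) y \<and> sem ?T (?L n y (\<sigma> a - n)) \<sigma>'))"
      by (rule ex_cong1, rule conj_cong, rule refl, simp only: loop, blast)
    also have "\<dots> \<longleftrightarrow> (\<exists>y0. rec_eval f ?xs y0 \<and> (\<exists>n y. n \<le> \<sigma> a \<and>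
        rec_eval (PrimRec f g) (n # ?xs) y \<and> \<sigma> a - n = 0 \<and> \<sigma>' = \<sigma>(d := y)))"
      unfolding tail ..
    also have "\<dots> \<longleftrightarrow> (\<exists>y. rec_eval (PrimRec f g) (\<sigma> a # ?xs) y \<and> \<sigma>' = \<sigma>(d := y))"
    proof -
      have "\<exists>y0. rec_eval f ?xs y0" if "rec_eval (PrimRec f g) (n # ?xs) y" for n y
        using that by (induction n arbitrary: y) auto
      then show ?thesis by (metis diff_is_0_eq diff_self_eq_0 le_antisym order_refl)
    qed
    finally show ?thesis by (simp add: Cons)
  qed
qed

lemma compiles_Mu:
  assumes f: "compiles f"
  shows "compiles (Mu f)"
  unfolding compiles_def
proof (intro allI impI)
  fix rs d m and \<sigma> \<sigma>' :: store
  assume *: "set rs \<subseteq> {..<m}" "d < m" "d \<notin> set rs" "\<forall>r\<ge>m. \<sigma> r = 0"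
  let ?xs = "map \<sigma> rs"
  \<comment> \<open>Register \<open>m\<close> holds the candidate and \<open>m + 1\<close> the value
    of \<open>f\<close> there. A further round passes \<open>Dec\<close> only if that value is
    positive, and the exit passes \<open>Test\<close> only if it is 0, so the number of rounds is
    forced.\<close>
  let ?L = "\<lambda>n. \<sigma>(m := n)"
  let ?C = "compile f (m # rs) (m + 1) (m + 2)"
  let ?B = "seqs [?C, Op (Dec (m + 1)), clear (m + 1), Op (Inc m)]"
  let ?T = "seqs [?C, Op (Test (m + 1)), copy m d (m + 2), clear m]"
  have C: "sem ?C (?L n) \<tau> \<longleftrightarrow> (\<exists>z. rec_eval f (n # ?xs) z \<and> \<tau> = (?L n)(m + 1 := z))" for n \<tau>
  proof -
    have "map (?L n) (m # rs) = n # ?xs" using *(1) by auto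
    moreover have "sem ?C (?L n) \<tau> \<longleftrightarrow>
        (\<exists>z. rec_eval f (map (?L n) (m # rs)) z \<and> \<tau> = (?L n)(m + 1 := z))"
      using * by (intro compilesD[OF f]) auto
    ultimately show ?thesis by (simp only:)
  qed
  have body: "sem ?B (?L n) \<tau> \<longleftrightarrow> (\<exists>y. rec_eval f (n # ?xs) (Suc y)) \<and> \<tau> = ?L (Suc n)" for n \<tau>
  proof -
    have "((?L n)(m + 1 := z, m + 1 := z - 1, m + 1 := 0)) = ?L n" for z
      using * by (auto simp: fun_eq_iff)
    moreover have "((?L n)(m + 1 := z)) (m + 1) = z" "(?L n)(m := Suc (?L n m)) = ?L (Suc n)" for z
      by auto
    ultimately have "sem ?B (?L n) \<tau> \<longleftrightarrow> (\<exists>z. rec_eval f (n # ?xs) z \<and> 0 < z \<and> \<tau> = ?L (Suc n))"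
      unfolding seqs.simps sem_Seq sem.simps(1) op_step.simps sem_clear C by metis
    then show ?thesis using gr0_conv_Suc by auto
  qed
  have loop: "(sem ?B)\<^sup>*\<^sup>* (?L 0) \<tau> \<longleftrightarrow>
      (\<exists>n. (\<forall>k<n. \<exists>y. rec_eval f (k # ?xs) (Suc y)) \<and> \<tau> = ?L n)" for \<tau>
  proof
    assume "(sem ?B)\<^sup>*\<^sup>* (?L 0) \<tau>"
    then show "\<exists>n. (\<forall>k<n. \<exists>y. rec_eval f (k # ?xs) (Suc y)) \<and> \<tau> = ?L n"
    proof induction
      case base
      show ?case by (rule exI[of _ 0]) simp
    next
      case (step \<tau> \<tau>')
      then obtain n where n: "\<forall>k<n. \<exists>y. rec_eval f (k # ?xs) (Suc y)" "\<tau> = ?L n" by blast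
      with step(2) have "\<exists>y. rec_eval f (n # ?xs) (Suc y)" "\<tau>' = ?L (Suc n)"
        unfolding n(2) body by auto
      with n(1) show ?case
        by - (rule exI[of _ "Suc n"], auto simp: less_Suc_eq)
    qed
  next
    have "(sem ?B)\<^sup>*\<^sup>* (?L 0) (?L n)" if "\<forall>k<n. \<exists>y. rec_eval f (k # ?xs) (Suc y)" for n
      using that
    proof (induction n)
      case (Suc n)
      then have "sem ?B (?L n) (?L (Suc n))" unfolding body by auto
      with Suc show ?case by (meson less_SucI rtranclp.rtrancl_into_rtrancl)
    qed simp
    then show "(sem ?B)\<^sup>*\<^sup>* (?L 0) \<tau>"
      if "\<exists>n. (\<forall>k<n. \<exists>y. rec_eval f (k # ?xs) (Suc y)) \<and> \<tau> = ?L n"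
      using that by blast
  qed
  have tail: "sem ?T (?L n) \<sigma>' \<longleftrightarrow> rec_eval f (n # ?xs) 0 \<and> \<sigma>' = \<sigma>(d := n)" for n
  proof -
    have "(?L n)(m + 1 := 0) = ?L n" using * by (auto simp: fun_eq_iff)
    moreover have "((?L n)(m + 1 := z)) (m + 1) = z" for z by simp
    ultimately have "sem ?T (?L n) \<sigma>' \<longleftrightarrow> rec_eval f (n # ?xs) 0 \<and>
        (\<exists>\<tau>. sem (copy m d (m + 2)) (?L n) \<tau> \<and> \<sigma>' = \<tau>(m := 0))"
      unfolding seqs.simps sem_Seq sem.simps(1) op_step.simps sem_clear C by metis
    moreover have "sem (copy m d (m + 2)) (?L n) \<tau> \<longleftrightarrow> \<tau> = (?L n)(d := n)" for \<tau>
      using * by (subst sem_copy) auto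
    moreover have "(?L n)(d := n, m := 0) = \<sigma>(d := n)"
      using * by (auto simp: fun_eq_iff)
    ultimately show ?thesis by simp
  qed
  have zero: "?L 0 = \<sigma>" using * by (auto simp: fun_eq_iff)
  have "compile (Mu f) rs d m = Seq (Loop ?B) ?T" by simp
  then have "sem (compile (Mu f) rs d m) \<sigma> \<sigma>' \<longleftrightarrow> (\<exists>\<tau>. (sem ?B)\<^sup>*\<^sup>* \<sigma> \<tau> \<and> sem ?T \<tau> \<sigma>')"
    by (simp only: sem_Seq sem.simps(3))
  also have "\<dots> \<longleftrightarrow> (\<exists>y. rec_eval (Mu f) ?xs y \<and> \<sigma>' = \<sigma>(d := y))"
    unfolding loop[unfolded zero] rec_eval_Mu_iff using tail by blast
  finally show "sem (compile (Mu f) rs d m) \<sigma> \<sigma>' \<longleftrightarrow>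
      (\<exists>y. rec_eval (Mu f) ?xs y \<and> \<sigma>' = \<sigma>(d := y))" .
qed

lemma compiles: "compiles f"
proof (induction f)
  case Zero
  show ?case by (simp add: compiles_def)
next
  case Succ
  show ?case by (auto simp: compiles_def length_Suc_conv sem_copy)
next
  case (Proj i)
  have "sem (copy (rs ! i) d m) \<sigma> \<sigma>' \<longleftrightarrow> \<sigma>' = \<sigma>(d := \<sigma> (rs ! i))"
    if "i < length rs" "set rs \<subseteq> {..<m}" "d < m" "d \<notin> set rs" "\<forall>r\<ge>m. \<sigma> r = 0"
    for rs d m and \<sigma> \<sigma>' :: store
  proof -
    have "rs ! i < m" "rs ! i \<noteq> d" using that(2-4) nth_mem[OF that(1)] by blast+
    then show ?thesis using that by (subst sem_copy) auto
  qed
  then show ?case by (auto simp: compiles_def)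
qed (auto intro: compiles_Comp compiles_PrimRec compiles_Mu)


section \<open>Counter automata\<close>

type_synonym edge = "nat \<times> op \<times> nat"

abbreviation source :: "edge \<Rightarrow> nat" where "source e \<equiv> fst e"
abbreviation instr :: "edge \<Rightarrow> op" where "instr e \<equiv> fst (snd e)"
abbreviation target :: "edge \<Rightarrow> nat" where "target e \<equiv> snd (snd e)"

primrec width :: "prog \<Rightarrow> nat" where
  "width (Op a) = 0"
| "width (Seq p q) = Suc (width p + width q)"
| "width (Loop p) = Suc (width p)"

text \<open>An automaton leading from state \<open>s\<close> to state \<open>t\<close>, with auxiliary states from \<open>n\<close> on.\<close>

primrec edges :: "prog \<Rightarrow> nat \<Rightarrow> nat \<Rightarrow> nat \<Rightarrow> edge list" where
  "edges (Op a) s t n = [(s, a, t)]"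
| "edges (Seq p q) s t n = edges p s n (Suc n) @ edges q n t (Suc n + width p)"
| "edges (Loop p) s t n = (s, Nop, n) # (n, Nop, t) # edges p n n (Suc n)"

lemma edges_states:
  "e \<in> set (edges p s t n) \<Longrightarrow> 
    source e \<in> {s, t} \<union> {n..<n + width p} \<and> target e \<in> {s, t} \<union> {n..<n + width p}"
proof (induction p arbitrary: s t n)
  case (Seq p q)
  then show ?case by (fastforce dest: Seq.IH)
next
  case (Loop p)
  then show ?case by (fastforce dest: Loop.IH)
qed auto

definition preserved :: "edge list \<Rightarrow> (nat \<Rightarrow> store \<Rightarrow> bool) \<Rightarrow> bool" where
  "preserved E I \<longleftrightarrow>
    (\<forall>e\<in>set E. \<forall>\<sigma> \<sigma>'. I (source e) \<sigma> \<longrightarrow> op_step (instr e) \<sigma> \<sigma>' \<longrightarrow> I (target e) \<sigma>')"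

lemma preserved_cong:
  assumes "preserved E I" "\<And>e. e \<in> set E \<Longrightarrow> J (source e) = I (source e) \<and> J (target e) = I (target e)"
  shows "preserved E J"
  using assms by (simp add: preserved_def)

text \<open>Soundness in the style of Floyd: assertions at the end points extend to an inductive assertion
  network, so that paths need not be decomposed.\<close>

lemma edges_invariant:
  assumes "s < n" "t < n" "\<And>\<sigma> \<sigma>'. I s \<sigma> \<Longrightarrow> sem p \<sigma> \<sigma>' \<Longrightarrow> I t \<sigma>'"
  shows "\<exists>J. (\<forall>q. q < n \<or> n + width p \<le> q \<longrightarrow> J q = I q) \<and> preserved (edges p s t n) J"
  using assms
proof (induction p arbitrary: s t n I)
  case (Op a)
  then show ?case by (intro exI[of _ I]) (auto simp: preserved_def)
next
  case (Seq p q)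
  \<comment> \<open>The cut state \<open>n\<close> between the two programs receives the strongest
    postcondition of \<open>p\<close>.\<close>
  let ?I = "I(n := \<lambda>\<tau>. \<exists>\<sigma>. I s \<sigma> \<and> sem p \<sigma> \<tau>)"
  obtain J where J: "\<forall>r. r < Suc n \<or> Suc n + width p \<le> r \<longrightarrow> J r = ?I r"
    "preserved (edges p s n (Suc n)) J"
    using Seq.IH(1)[of s "Suc n" n ?I] Seq.prems(1) by auto
  have "J t \<sigma>'" if "J n \<sigma>" "sem q \<sigma> \<sigma>'" for \<sigma> \<sigma>'
    using that J(1) Seq.prems by auto
  then obtain K where K: "\<forall>r. r < Suc n + width p \<or> Suc n + width p + width q \<le> r \<longrightarrow> K r = J r"
    "preserved (edges q n t (Suc n + width p)) K"
    using Seq.IH(2)[of n "Suc n + width p" t J] Seq.prems(2) by auto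
  have "K r = I r" if "r < n \<or> n + width (Seq p q) \<le> r" for r
    using that J(1) K(1) by auto
  \<comment> \<open>Adding the assertions for \<open>q\<close> changes only its own auxiliary
    states, and no edge of \<open>p\<close> touches these.\<close>
  moreover have "preserved (edges p s n (Suc n)) K"
    using J(2)
  proof (rule preserved_cong)
    fix e assume "e \<in> set (edges p s n (Suc n))"
    from edges_states[OF this] show "K (source e) = J (source e) \<and> K (target e) = J (target e)"
      using K(1) Seq.prems(1) by auto
  qed
  ultimately show ?case
    using K(2) by (intro exI[of _ K]) (auto simp: preserved_def)
next
  case (Loop p)
  \<comment> \<open>The new hub state \<open>n\<close> carries the loop invariant: all stores
    reached by iterating the body from \<open>I s\<close>.\<close>
  let ?I = "I(n := \<lambda>\<tau>. \<exists>\<sigma>. I s \<sigma> \<and> (sem p)\<^sup>*\<^sup>* \<sigma> \<tau>)"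
  have "?I n \<sigma>'" if "?I n \<sigma>" "sem p \<sigma> \<sigma>'" for \<sigma> \<sigma>'
    using that by (auto intro: rtranclp.rtrancl_into_rtrancl)
  then obtain J where J: "\<forall>r. r < Suc n \<or> Suc n + width p \<le> r \<longrightarrow> J r = ?I r"
    "preserved (edges p n n (Suc n)) J"
    using Loop.IH[of n "Suc n" n ?I] by auto
  then show ?case using Loop.prems
    by (intro exI[of _ J]) (auto simp: preserved_def)
qed


definition state :: "edge list \<Rightarrow> nat" where
  "state es = (if es = [] then 0 else target (last es))"

lemma state_simps [simp]: "state [] = 0" "state (es @ [e]) = target e"
  by (simp_all add: state_def)

lemma state_replicate [simp]:
  "state (es @ replicate k e) = (if k = 0 then state es else target e)"
  "state (replicate k e) = (if k = 0 then 0 else target e)"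
  by (simp_all add: state_def)

text \<open>In states 0 and 1 the input is loaded into the registers 0 and 1. The two start edges leave
  these states; a run is one on the input \<open>(x, y)\<close> if the start edges are taken at the right
  time.\<close>

definition start0 :: edge where "start0 = (0, Nop, 1)"
definition start1 :: edge where "start1 = (1, Nop, 2)"

definition automaton :: "prog \<Rightarrow> edge list" where
  "automaton p = [(0, Inc 0, 0), start0, (1, Inc 1, 1), start1] @ edges p 2 3 4"

text \<open>Indices count from 0: \<open>x\<close> increments precede \<open>start0\<close>, which
  therefore has index \<open>x\<close>; after \<open>y\<close> further increments
  \<open>start1\<close> has index \<open>Suc (x + y)\<close>.\<close>

definition timely :: "nat \<Rightarrow> nat \<Rightarrow> nat \<Rightarrow> edge \<Rightarrow> bool" where
  "timely x y k e \<longleftrightarrow> (e = start0 \<longrightarrow> k = x) \<and> (e = start1 \<longrightarrow> k = Suc (x + y))"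

inductive run :: "edge list \<Rightarrow> nat \<Rightarrow> nat \<Rightarrow> edge list \<Rightarrow> store \<Rightarrow> bool" for E x y where
  Nil: "run E x y [] (\<lambda>_. 0)"
| snoc: "run E x y es \<sigma> \<Longrightarrow> e \<in> set E \<Longrightarrow> source e = state es \<Longrightarrow> timely x y (length es) e \<Longrightarrow>
    op_step (instr e) \<sigma> \<sigma>' \<Longrightarrow> run E x y (es @ [e]) \<sigma>'"

abbreviation input :: "nat \<Rightarrow> nat \<Rightarrow> store" where
  "input x y \<equiv> (\<lambda>_. 0)(0 := x, 1 := y)"

lemma run_sound:
  assumes "run (automaton p) x y es \<sigma>" "state es = 3"
  shows "sem p (input x y) \<sigma>"
proof -
  let ?I = "(\<lambda>_ _. False)(2 := \<lambda>\<sigma>. \<sigma> = input x y, 3 := \<lambda>\<sigma>. sem p (input x y) \<sigma>)"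
  obtain J where J: "\<forall>q. q < 4 \<or> 4 + width p \<le> q \<longrightarrow> J q = ?I q" "preserved (edges p 2 3 4) J"
    using edges_invariant[of 2 4 3 ?I p] by auto
  have ends: "J 0 = (\<lambda>_. False)" "J 1 = (\<lambda>_. False)" "J (Suc 0) = (\<lambda>_. False)"
    "J 2 = (\<lambda>\<sigma>. \<sigma> = input x y)" "J 3 = (\<lambda>\<sigma>. sem p (input x y) \<sigma>)"
    using J(1) by auto
  have states: "2 \<le> source e \<and> 2 \<le> target e" if "e \<in> set (edges p 2 3 4)" for e
    using edges_states[OF that] by auto
  \<comment> \<open>In the two loading states the store is determined by the number \<open>k\<close>
    of moves made, and timeliness of the start edges turns these numbers into \<open>x\<close> and
    \<open>y\<close>. All other states use the assertions \<open>J\<close> of the program.\<close>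
  define K where "K k q \<sigma> \<longleftrightarrow> (if q = 0 then \<sigma> = (\<lambda>_. 0)(0 := k)
    else if q = 1 then Suc x \<le> k \<and> \<sigma> = input x (k - Suc x) else J q \<sigma>)" for k q and \<sigma> :: store
  have "K (length es) (state es) \<sigma>"
    using assms(1)
  proof induction
    case Nil
    show ?case by (simp add: K_def fun_upd_def)
  next
    case (snoc es \<sigma> e \<sigma>')
    have K: "K (length es) (source e) \<sigma>" using snoc.IH snoc.hyps(3) by simp
    consider "e = (0, Inc 0, 0)" | "e = start0" | "e = (1, Inc 1, 1)" | "e = start1"
      | "e \<in> set (edges p 2 3 4)"
      using snoc.hyps(2) by (auto simp: automaton_def)
    then have "K (Suc (length es)) (target e) \<sigma>'"
    proof cases
      case 1
      then show ?thesis using K snoc.hyps(5) by (auto simp: K_def)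
    next
      case 2
      then show ?thesis using K snoc.hyps(4,5) by (auto simp: K_def timely_def start0_def)
    next
      case 3
      then show ?thesis using K snoc.hyps(5) by (auto simp: K_def Suc_diff_Suc Suc_le_eq)
    next
      case 4
      then show ?thesis using K snoc.hyps(4,5)
        by (auto simp: K_def timely_def start1_def start0_def ends)
    next
      case 5
      then show ?thesis using K snoc.hyps(5) states[OF 5] J(2) by (auto simp: K_def preserved_def)
    qed
    then show ?case by simp
  qed
  then show ?thesis using assms(2) ends by (simp add: K_def)
qed

text \<open>The bounds on \<open>s\<close> and \<open>n\<close> keep the program away from states 0
  and 1. Its edges are thus not start edges, and the timing condition is vacuous for them.\<close>

lemma run_edges:
  assumes "sem p \<sigma> \<sigma>'" "set (edges p s t n) \<subseteq> set E" "2 \<le> s" "2 \<le> n"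
    "run E x y es \<sigma>" "state es = s"
  shows "\<exists>es'. run E x y es' \<sigma>' \<and> state es' = t"
  using assms
proof (induction p arbitrary: s t n \<sigma> \<sigma>' es)
  case (Op a)
  have "run E x y (es @ [(s, a, t)]) \<sigma>'"
    by (rule run.snoc[OF Op.prems(5)]) (use Op.prems in \<open>auto simp: timely_def start0_def start1_def\<close>)
  then show ?case by (intro exI[of _ "es @ [(s, a, t)]"]) simp
next
  case (Seq p q)
  from Seq.prems(1) obtain \<tau> where \<tau>: "sem p \<sigma> \<tau>" "sem q \<tau> \<sigma>'" by auto
  obtain es' where "run E x y es' \<tau>" "state es' = n"
    using Seq.IH(1)[OF \<tau>(1), of s n "Suc n" es] Seq.prems by auto
  then show ?case using Seq.IH(2)[OF \<tau>(2), of n t "Suc n + width p" es'] Seq.prems by auto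
next
  case (Loop p)
  have nop: "\<exists>es'. run E x y es' \<tau> \<and> state es' = r" if "run E x y es \<tau>" "state es = q"
    "2 \<le> q" "(q, Nop, r) \<in> set E" for es \<tau> q r
  proof -
    have "run E x y (es @ [(q, Nop, r)]) \<tau>"
      by (rule run.snoc[OF that(1)]) (use that in \<open>auto simp: timely_def start0_def start1_def\<close>)
    then show ?thesis by (intro exI[of _ "es @ [(q, Nop, r)]"]) simp
  qed
  have "(sem p)\<^sup>*\<^sup>* \<sigma> \<sigma>'" using Loop.prems(1) by simp
  then have "\<exists>es'. run E x y es' \<sigma>' \<and> state es' = n"
  proof induction
    case base
    show ?case using nop[OF Loop.prems(5,6,3)] Loop.prems(2) by simp
  next
    case (step \<tau> \<tau>')
    then obtain es' where "run E x y es' \<tau>" "state es' = n" by blast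
    with Loop.IH[OF step(2), of n n "Suc n" es'] Loop.prems show ?case by auto
  qed
  then obtain es' where "run E x y es' \<sigma>'" "state es' = n" by blast
  then show ?case using nop[of es' \<sigma>' n t] Loop.prems by simp
qed

lemma run_complete:
  assumes "sem p (input x y) \<sigma>"
  shows "\<exists>es. run (automaton p) x y es \<sigma> \<and> state es = 3"
proof -
  let ?E = "automaton p"
  have "run ?E x y (replicate k (0, Inc 0, 0)) ((\<lambda>_. 0)(0 := k))" for k
  proof (induction k)
    case 0
    show ?case using run.Nil by (simp add: fun_upd_def)
  next
    case (Suc k)
    have "run ?E x y (replicate k (0, Inc 0, 0) @ [(0, Inc 0, 0)]) ((\<lambda>_. 0)(0 := Suc k))"
      by (rule run.snoc[OF Suc]) (auto simp: automaton_def timely_def start0_def start1_def)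
    then show ?case by (simp only: replicate_append_same replicate_Suc)
  qed
  then have "run ?E x y (replicate x (0, Inc 0, 0) @ [start0]) ((\<lambda>_. 0)(0 := x))"
    by (rule run.snoc) (auto simp: automaton_def timely_def start0_def start1_def)
  then have 0: "run ?E x y ((replicate x (0, Inc 0, 0) @ [start0]) @ replicate k (1, Inc 1, 1)) (input x k)"
    for k
  proof (induction k)
    case 0
    have "input x 0 = (\<lambda>_. 0)(0 := x)" by auto
    with 0 show ?case by (simp only: replicate_0 append_Nil2)
  next
    case (Suc k)
    have "run ?E x y (((replicate x (0, Inc 0, 0) @ [start0]) @ replicate k (1, Inc 1, 1)) @
        [(1, Inc 1, 1)]) (input x (Suc k))"
      by (rule run.snoc[OF Suc.IH[OF Suc.prems]])
        (auto simp: automaton_def timely_def start0_def start1_def state_def)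
    then show ?case by (simp only: replicate_append_same replicate_Suc append_assoc)
  qed
  have "run ?E x y (((replicate x (0, Inc 0, 0) @ [start0]) @ replicate y (1, Inc 1, 1)) @ [start1])
      (input x y)"
    by (rule run.snoc[OF 0]) (auto simp: automaton_def timely_def start0_def start1_def state_def)
  then show ?thesis
    by (rule run_edges[OF assms, of 2 3 4, rotated 3]) (auto simp: automaton_def start1_def state_def)
qed


section \<open>Representing runs by data words\<close>

text \<open>A decrement of any register ends the activity. It need not be matched with
  \<open>r\<close>, since in a valid word a process increments only one register.\<close>

definition active :: "nat \<Rightarrow> (edge \<times> proc) list \<Rightarrow> proc set" where
  "active r us = {p. (\<exists>e. (e, p) \<in> set us \<and> instr e = Inc r) \<and>
    \<not> (\<exists>e r'. (e, p) \<in> set us \<and> instr e = Dec r')}"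

primrec playable :: "op \<Rightarrow> proc \<Rightarrow> (edge \<times> proc) list \<Rightarrow> bool" where
  "playable (Inc r) p us \<longleftrightarrow> p \<notin> snd ` set us"
| "playable (Dec r) p us \<longleftrightarrow> p \<in> active r us"
| "playable (Test r) p us \<longleftrightarrow> active r us = {}"
| "playable Nop p us \<longleftrightarrow> True"

definition legal :: "edge list \<Rightarrow> (edge \<times> proc) list \<Rightarrow> edge \<times> proc \<Rightarrow> bool" where
  "legal E us l \<longleftrightarrow> fst l \<in> set E \<and> source (fst l) = state (map fst us) \<and>
    playable (instr (fst l)) (snd l) us"

inductive valid :: "edge list \<Rightarrow> nat \<Rightarrow> nat \<Rightarrow> (edge \<times> proc) list \<Rightarrow> bool" for E x y where
  Nil: "valid E x y []"
| snoc: "valid E x y us \<Longrightarrow> legal E us l \<Longrightarrow> timely x y (length us) (fst l) \<Longrightarrow> valid E x y (us @ [l])"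

lemma active_subset: "active r us \<subseteq> snd ` set us"
  by (force simp: active_def)

lemma finite_active [simp]: "finite (active r us)"
  by (rule finite_subset[OF active_subset]) simp

text \<open>An increment requires a process that has not moved at all so far, so no process
  increments twice.\<close>

lemma valid_increments:
  "valid E x y us \<Longrightarrow> (e, p) \<in> set us \<Longrightarrow> (e', p) \<in> set us \<Longrightarrow>
    instr e = Inc r \<Longrightarrow> instr e' = Inc r' \<Longrightarrow> r = r'"
proof (induction arbitrary: e e' r r' rule: valid.induct)
  case (snoc us l)
  have fresh: "(g, p) \<notin> set us" if "l = (f, p)" "instr f = Inc k" for f g k
    using snoc.hyps(2) that by (force simp: legal_def)
  have "(e, p) \<in> set us \<or> l = (e, p)" "(e', p) \<in> set us \<or> l = (e', p)"
    using snoc.prems(1,2) by auto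
  then show ?case
    using snoc.IH snoc.prems(3,4) fresh by (metis op.inject(1) prod.inject)
qed simp

text \<open>Cardinalities of active sets simulate the registers. A decrement removes its process
  from every active set, but by \<open>valid_increments\<close> the process was in only one of
  them.\<close>

lemma active_snoc:
  assumes "valid E x y us" "legal E us (e, p)"
  shows "op_step (instr e) (\<lambda>r. card (active r us)) (\<lambda>r. card (active r (us @ [(e, p)])))"
proof (cases "instr e")
  case (Inc k)
  then have p: "p \<notin> snd ` set us" using assms(2) by (simp add: legal_def)
  have "active r (us @ [(e, p)]) = (if r = k then insert p (active r us) else active r us)" for r
    using p Inc by (auto simp: active_def image_iff simp del: split_paired_Ex split_paired_All)
  moreover have "p \<notin> active k us" using p active_subset by blast
  ultimately show ?thesis using Inc by (auto simp: fun_eq_iff)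
next
  case (Dec k)
  then have p: "p \<in> active k us" using assms(2) by (simp add: legal_def)
  have "active r (us @ [(e, p)]) = active r us - {p}" for r
    using Dec by (auto simp: active_def simp del: split_paired_Ex split_paired_All)
  moreover have "p \<notin> active r us" if "r \<noteq> k" for r
    using p that valid_increments[OF assms(1)] by (auto simp: active_def)
  moreover have "0 < card (active k us)" using p by (auto simp: card_gt_0_iff)
  ultimately show ?thesis using Dec p by (auto simp: fun_eq_iff)
next
  case (Test k)
  then have "active r (us @ [(e, p)]) = active r us" for r by (auto simp: active_def)
  then show ?thesis using Test assms(2) by (simp add: legal_def)
next
  case Nop
  then have "active r (us @ [(e, p)]) = active r us" for r by (auto simp: active_def)
  then show ?thesis using Nop by simp
qed

lemma op_step_deterministic: "op_step a \<sigma> \<tau> \<Longrightarrow> op_step a \<sigma> \<tau>' \<Longrightarrow> \<tau> = \<tau>'"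
  by (cases a) auto

lemma valid_run: "valid E x y us \<Longrightarrow> run E x y (map fst us) (\<lambda>r. card (active r us))"
proof (induction rule: valid.induct)
  case Nil
  show ?case using run.Nil by (simp add: active_def)
next
  case (snoc us l)
  have "run E x y (map fst us @ [fst l]) (\<lambda>r. card (active r (us @ [l])))"
    by (rule run.snoc[OF snoc.IH])
      (use snoc.hyps active_snoc[of E x y us "fst l" "snd l"] in \<open>auto simp: legal_def\<close>)
  then show ?case by simp
qed

lemma run_valid:
  "run E x y es \<sigma> \<Longrightarrow> \<exists>us. map fst us = es \<and> valid E x y us \<and> (\<forall>r. card (active r us) = \<sigma> r) \<and>
    snd ` set us \<subseteq> {..<length us}"
proof (induction rule: run.induct)
  case Nil
  show ?case using valid.Nil by (intro exI[of _ "[]"]) (auto simp: active_def)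
next
  case (snoc es \<sigma> e \<sigma>')
  then obtain us where us: "map fst us = es" "valid E x y us" "(\<lambda>r. card (active r us)) = \<sigma>"
    "snd ` set us \<subseteq> {..<length us}" by blast
  have "\<exists>p \<le> length us. playable (instr e) p us"
  proof (cases "instr e")
    case (Inc r)
    \<comment> \<open>All names used so far are below \<open>length us\<close>, so this one is
      fresh.\<close>
    then show ?thesis using us(4) by (intro exI[of _ "length us"]) auto
  next
    case (Dec r)
    then have "active r us \<noteq> {}" using snoc.hyps(5) us(3) by force
    then show ?thesis using Dec active_subset us(4) by fastforce
  next
    case (Test r)
    then have "card (active r us) = 0" using snoc.hyps(5) us(3) by auto
    then show ?thesis using Test by auto
  qed auto
  then obtain p where p: "p \<le> length us" "playable (instr e) p us" by blast
  have legal: "legal E us (e, p)"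
    using snoc.hyps p us(1) by (simp add: legal_def)
  have "valid E x y (us @ [(e, p)])"
    by (rule valid.snoc[OF us(2) legal]) (use snoc.hyps us(1) in auto)
  moreover have "(\<lambda>r. card (active r (us @ [(e, p)]))) = \<sigma>'"
    using op_step_deterministic[OF active_snoc[OF us(2) legal]] snoc.hyps(5) us(3) by simp
  ultimately show ?case using us p
    by (intro exI[of _ "us @ [(e, p)]"]) (auto simp: fun_eq_iff)
qed

lemma valid_take: "valid E x y us \<Longrightarrow> k < length us \<Longrightarrow>
    legal E (take k us) (us ! k) \<and> timely x y k (fst (us ! k))"
proof (induction rule: valid.induct)
  case (snoc us l)
  then show ?case by (cases "k = length us") (auto simp: nth_append)
qed simp

lemma valid_if_take:
  "(\<And>k. k < length us \<Longrightarrow> legal E (take k us) (us ! k) \<and> timely x y k (fst (us ! k))) \<Longrightarrow>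
    valid E x y us"
proof (induction us rule: rev_induct)
  case Nil
  show ?case by (rule valid.Nil)
next
  case (snoc l us)
  have "valid E x y us"
  proof (rule snoc.IH)
    fix k assume "k < length us"
    then show "legal E (take k us) (us ! k) \<and> timely x y k (fst (us ! k))"
      using snoc.prems[of k] by (simp add: nth_append)
  qed
  then show ?case using snoc.prems[of "length us"] by (auto intro: valid.snoc)
qed

lemma accepting_run_iff:
  "(\<exists>us. valid (automaton p) x y us \<and> state (map fst us) = 3) \<longleftrightarrow> (\<exists>\<sigma>. sem p (input x y) \<sigma>)"
  using valid_run run_sound run_complete run_valid by metis


section \<open>The specification\<close>

instance op :: countable
  by countable_datatype

text \<open>Action 0 is the only action of Environment, with which it challenges the last move of System.\<close>

definition code :: "edge \<Rightarrow> action" where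
  "code e = Suc (to_nat e)"

lemma code_eq_iff [simp]: "code e = code e' \<longleftrightarrow> e = e'"
  by (simp add: code_def)

lemma code_pos [simp]: "0 < code e" "code e \<noteq> 0" "0 \<noteq> code e"
  by (simp_all add: code_def)

primrec other :: "var \<Rightarrow> var" where
  "other VX = VY"
| "other VY = VX"

lemma other_neq [simp]: "other v \<noteq> v" "v \<noteq> other v"
  by (cases v; simp)+

definition falsum :: form where
  "falsum = Ex VX (Neg (Eq VX VX))"

primrec has :: "edge list \<Rightarrow> var \<Rightarrow> form" where
  "has [] v = falsum"
| "has (e # F) v = Or (Act (code e) v) (has F v)"

definition before :: "edge list \<Rightarrow> var \<Rightarrow> form" where
  "before E v = And (has E v) (Neg (Ex (other v) (And (Less (other v) v) (Act 0 (other v)))))"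

definition final :: "edge list \<Rightarrow> var \<Rightarrow> form" where
  "final E v = And (before E v) (Neg (Ex (other v) (And (Less v (other v)) (before E (other v)))))"

text \<open>A substitute for the successor relation: a later move exists and each later move is the
  last one. \<open>final\<close> at the other variable rebinds \<open>v\<close>, so two variables
  suffice.\<close>

definition penultimate :: "edge list \<Rightarrow> var \<Rightarrow> form" where
  "penultimate E v = And (And (before E v) (Neg (final E v)))
    (All (other v) (Or (Neg (And (Less v (other v)) (before E (other v)))) (final E (other v))))"

text \<open>Evaluated with \<open>VX\<close> at the last move. The state before it is the target of
  the penultimate move, or the initial state 0 if nothing precedes.\<close>

definition in_state :: "edge list \<Rightarrow> nat \<Rightarrow> form" where
  "in_state E q = Or (if q = 0 then Neg (Ex VY (Less VY VX)) else falsum)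
    (Ex VY (And (penultimate E VY) (has (filter (\<lambda>e. target e = q) E) VY)))"

definition incs :: "edge list \<Rightarrow> nat \<Rightarrow> edge list" where
  "incs E r = filter (\<lambda>e. instr e = Inc r) E"

definition decs :: "edge list \<Rightarrow> edge list" where
  "decs E = filter (\<lambda>e. \<exists>r. instr e = Dec r) E"

text \<open>In the case of \<open>Test\<close> both variables are spent on matching increments with
  decrements, so the position of the tested move is lost. The first challenge replaces it as the
  point of reference, by way of \<open>before\<close>; in the cases of \<open>Inc\<close> and
  \<open>Dec\<close> \<open>VX\<close> stays on the move.\<close>

primrec play :: "edge list \<Rightarrow> op \<Rightarrow> form" where
  "play E (Inc r) = Neg (Ex VY (And (Less VY VX) (Sim VY VX)))"
| "play E (Dec r) = And (Ex VY (And (And (Less VY VX) (Sim VY VX)) (has (incs E r) VY)))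
    (Neg (Ex VY (And (And (Less VY VX) (Sim VY VX)) (has (decs E) VY))))"
| "play E (Test r) = All VY (Or (Neg (And (before E VY) (has (incs E r) VY)))
    (Ex VX (And (And (before E VX) (Sim VX VY)) (has (decs E) VX))))"
| "play E Nop = Neg falsum"

primrec move :: "edge list \<Rightarrow> edge list \<Rightarrow> form" where
  "move E [] = falsum"
| "move E (e # F) = Or (And (Act (code e) VX) (And (in_state E (source e)) (play E (instr e)))) (move E F)"

definition check :: "edge list \<Rightarrow> form" where
  "check E = All VX (Or (Neg (final E VX)) (move E E))"

text \<open>The process sets are chosen in favour of System; the first conjunct keeps it from
  leaving Environment without a process and hence without challenges.\<close>

definition spec :: "edge list \<Rightarrow> form" where
  "spec E = And (Ex VX (IsE VX)) (And (check E)
    (Or (Ex VX (Act 0 VX)) (Ex VX (has (filter (\<lambda>e. target e = 3) E) VX))))"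

text \<open>A descending chain of \<open>n\<close> further positions below \<open>VX\<close>. The
  equality copies \<open>VY\<close> back into \<open>VX\<close>, so that the chain can be walked
  with two variables.\<close>

primrec later :: "nat \<Rightarrow> form" where
  "later 0 = Neg falsum"
| "later (Suc n) = Ex VY (And (Less VY VX) (Ex VX (And (Eq VX VY) (later n))))"

definition at_time :: "edge \<Rightarrow> nat \<Rightarrow> form" where
  "at_time e n = All VX (Or (Neg (Act (code e) VX)) (And (later n) (Neg (later (Suc n)))))"

definition on_input :: "nat \<Rightarrow> nat \<Rightarrow> form" where
  "on_input x y = And (at_time start0 x) (at_time start1 (Suc (x + y)))"

section \<open>Free variables and actions of the formulas\<close>

lemma free_vars_has: "free_vars (has F v) \<subseteq> {v}"
  by (induction F) (auto simp: falsum_def)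

lemma free_vars_before: "free_vars (before E v) \<subseteq> {v}"
  using free_vars_has[of E v] by (auto simp: before_def)

lemma free_vars_final: "free_vars (final E v) \<subseteq> {v}"
  using free_vars_before[of E v] free_vars_before[of E "other v"] by (auto simp: final_def)

lemma var_cases: "v = VX \<or> v = VY"
  by (cases v) auto

lemma free_vars_in_state: "free_vars (in_state E q) \<subseteq> {VX}"
  using var_cases by (auto simp: in_state_def falsum_def)

lemma free_vars_play: "free_vars (play E a) \<subseteq> {VX}"
  using free_vars_has[of _ VX] free_vars_before[of E VX]  var_cases by (cases a) (auto simp: falsum_def)

lemma free_vars_move: "free_vars (move E F) \<subseteq> {VX}"
  using free_vars_in_state free_vars_play by (induction F) (auto simp: falsum_def)

lemma free_vars_spec: "free_vars (spec E) = {}"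
  using free_vars_has[of _ VX] free_vars_final[of E VX] free_vars_move[of E E]
  by (auto simp: spec_def check_def)

lemma free_vars_on_input: "free_vars (on_input x y) = {}"
proof -
  have "free_vars (later n) \<subseteq> {VX}" for n
    using var_cases by (induction n) (auto simp: falsum_def)
  then show ?thesis by (auto simp: on_input_def at_time_def simp del: later.simps)
qed

lemma actions_has: "actions (has F v) \<subseteq> code ` set F"
  by (induction F) (auto simp: falsum_def)

lemma actions_has_filter: "actions (has (filter P F) v) \<subseteq> code ` set F"
  using actions_has[of "filter P F"] by fastforce

lemma actions_before: "actions (before E v) \<subseteq> insert 0 (code ` set E)"
  using actions_has[of E v] by (auto simp: before_def)

lemma actions_final: "actions (final E v) \<subseteq> insert 0 (code ` set E)"
  using actions_before[of E] by (auto simp: final_def)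

lemma actions_penultimate: "actions (penultimate E v) \<subseteq> insert 0 (code ` set E)"
  using actions_before[of E] actions_final[of E] by (auto simp: penultimate_def)

lemma actions_in_state: "actions (in_state E q) \<subseteq> insert 0 (code ` set E)"
  using actions_penultimate[of E VY] actions_has_filter[of "\<lambda>e. target e = q" E VY]
  by (auto simp: in_state_def falsum_def)

lemma actions_play: "actions (play E a) \<subseteq> insert 0 (code ` set E)"
proof -
  have "actions (has (incs E r) v) \<subseteq> code ` set E" "actions (has (decs E) v) \<subseteq> code ` set E" for r v
    unfolding incs_def decs_def by (rule actions_has_filter)+
  then show ?thesis
    using actions_before[of E VX] actions_before[of E VY] by (cases a) (simp_all add: falsum_def, blast+)
qed

lemma actions_move: "actions (move E F) \<subseteq> insert 0 (code ` (set E \<union> set F))"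
proof (induction F)
  case (Cons e F)
  have "actions (in_state E q) \<union> actions (play E a) \<subseteq> insert 0 (code ` (set E \<union> set (e # F)))" for q a
    using actions_in_state[of E q] actions_play[of E a] by auto
  with Cons show ?case by auto
qed (simp add: falsum_def)

lemma actions_spec: "actions (spec E) \<subseteq> insert 0 (code ` set E)"
  using actions_final[of E VX] actions_move[of E E]
    actions_has_filter[of "\<lambda>e. target e = 3" E VX]
  by (auto simp: spec_def check_def)

lemma actions_on_input: "actions (on_input x y) = {code start0, code start1}"
proof -
  have "actions (later n) = {}" for n by (induction n) (auto simp: falsum_def)
  then show ?thesis by (auto simp: on_input_def at_time_def simp del: later.simps)
qed


section \<open>Semantics of the specification\<close>

declare split_paired_All [simp del] split_paired_Ex [simp del]

lemma Position_in_domain [simp]: "Position i \<in> domain PS PE w \<longleftrightarrow> i \<in> positions w"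
  by (auto simp: domain_def)

lemma Ex_domain:
  "(\<exists>e\<in>domain PS PE w. P e) \<longleftrightarrow> (\<exists>i\<in>positions w. P (Position i)) \<or> (\<exists>p\<in>PS \<union> PE. P (Process p))"
  by (auto simp: domain_def)

lemma All_domain:
  "(\<forall>e\<in>domain PS PE w. P e) \<longleftrightarrow> (\<forall>i\<in>positions w. P (Position i)) \<and> (\<forall>p\<in>PS \<union> PE. P (Process p))"
  by (auto simp: domain_def)

lemma positions_downward: "i \<in> positions w \<Longrightarrow> j \<le> i \<Longrightarrow> j \<in> positions w"
  by (cases w) auto

lemma sat_falsum [simp]: "\<not> sat PS PE w s falsum"
  by (simp add: falsum_def)

lemma sat_has [simp]:
  "sat PS PE w s (has F v) \<longleftrightarrow> (\<exists>i. s v = Position i \<and> (\<exists>e\<in>set F. fst (letter_at w i) = code e))"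
  by (induction F) auto

lemma sat_later:
  "s VX = Position i \<Longrightarrow> i \<in> positions w \<Longrightarrow> sat PS PE w s (later n) \<longleftrightarrow> n \<le> i"
proof (induction n arbitrary: s i)
  case (Suc n)
  have "sat PS PE w (s(VY := Position j, VX := Position j)) (later n) \<longleftrightarrow> n \<le> j" if "j < i" for j
    using Suc.IH that positions_downward[OF Suc.prems(2)] by simp
  moreover have "sat PS PE w s (later (Suc n)) \<longleftrightarrow>
      (\<exists>j<i. sat PS PE w (s(VY := Position j, VX := Position j)) (later n))"
    using Suc.prems positions_downward[OF Suc.prems(2)] by (auto simp: Ex_domain)
  ultimately have "sat PS PE w s (later (Suc n)) \<longleftrightarrow> (\<exists>j<i. n \<le> j)" by auto
  then show ?case by (auto simp: Suc_le_eq)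
qed simp

lemma sat_at_time:
  "sat PS PE w s (at_time e n) \<longleftrightarrow> (\<forall>i\<in>positions w. fst (letter_at w i) = code e \<longrightarrow> i = n)"
  by (auto simp: at_time_def All_domain sat_later simp del: later.simps)

lemma sat_on_input:
  "sat PS PE w s (on_input x y) \<longleftrightarrow>
    (\<forall>i\<in>positions w. \<forall>e. fst (letter_at w i) = code e \<longrightarrow> timely x y i e)"
  unfolding on_input_def sat.simps sat_at_time timely_def by blast

text \<open>The list \<open>us\<close> consists of the moves before the first challenge.\<close>

locale challenged_word =
  fixes E :: "edge list" and us :: "(edge \<times> proc) list" and w :: dword and PS PE :: "proc set"
  assumes letters: "i < length us \<Longrightarrow> i \<in> positions w \<and> letter_at w i = map_prod code id (us ! i)"
    and edges: "fst ` set us \<subseteq> set E"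
    and challenge: "length us \<in> positions w \<Longrightarrow> fst (letter_at w (length us)) = 0"
begin

lemma edge_nth: "i < length us \<Longrightarrow> fst (us ! i) \<in> set E"
  using edges by auto

lemma sat_before:
  assumes "s v \<in> domain PS PE w"
  shows "sat PS PE w s (before E v) \<longleftrightarrow> (\<exists>i<length us. s v = Position i)"
proof (cases "s v")
  case (Position i)
  then have i: "i \<in> positions w" using assms by simp
  have "sat PS PE w s (before E v) \<longleftrightarrow>
      (\<exists>e\<in>set E. fst (letter_at w i) = code e) \<and> \<not> (\<exists>j<i. fst (letter_at w j) = 0)"
    using positions_downward[OF i] by (auto simp: before_def Position Ex_domain)
  also have "\<dots> \<longleftrightarrow> i < length us"
  proof (cases "i < length us")
    case True
    then show ?thesis using letters edge_nth by auto
  next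
    case False
    \<comment> \<open>Positions form an initial segment, so a position beyond the moves implies that
      the first challenge exists, at or before it.\<close>
    then have "length us \<in> positions w" using positions_downward[OF i] by simp
    then have "fst (letter_at w (length us)) = 0" by (rule challenge)
    moreover have "length us < i \<or> i = length us" using False by auto
    ultimately show ?thesis using False by auto
  qed
  finally show ?thesis using Position by simp
qed (simp add: before_def)

lemma sat_final:
  assumes "s v \<in> domain PS PE w"
  shows "sat PS PE w s (final E v) \<longleftrightarrow> (\<exists>i. s v = Position i \<and> Suc i = length us)"
proof -
  have "sat PS PE w s (final E v) \<longleftrightarrow> (\<exists>i<length us. s v = Position i \<and>
      \<not> (\<exists>j\<in>positions w. i < j \<and> j < length us))"
    using assms by (auto simp: final_def sat_before Ex_domain)
  also have "\<dots> \<longleftrightarrow> (\<exists>i. s v = Position i \<and> Suc i = length us)"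
    using letters by (metis Suc_lessI lessI less_antisym not_less_eq)
  finally show ?thesis .
qed

lemma sat_penultimate:
  assumes "s v \<in> domain PS PE w"
  shows "sat PS PE w s (penultimate E v) \<longleftrightarrow> (\<exists>i. s v = Position i \<and> Suc (Suc i) = length us)"
proof -
  have "sat PS PE w s (penultimate E v) \<longleftrightarrow> (\<exists>i<length us. s v = Position i \<and> Suc i \<noteq> length us \<and>
      (\<forall>j\<in>positions w. i < j \<and> j < length us \<longrightarrow> Suc j = length us))"
    using assms by (auto simp: penultimate_def sat_before sat_final All_domain)
  also have "\<dots> \<longleftrightarrow> (\<exists>i. s v = Position i \<and> Suc (Suc i) = length us)"
  proof -
    have "Suc i \<noteq> length us \<and> (\<forall>j\<in>positions w. i < j \<and> j < length us \<longrightarrow> Suc j = length us) \<longleftrightarrow>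
        Suc (Suc i) = length us" if "i < length us" for i
    proof
      assume *: "Suc i \<noteq> length us \<and>
        (\<forall>j\<in>positions w. i < j \<and> j < length us \<longrightarrow> Suc j = length us)"
      then have "Suc i < length us" using that by simp
      moreover from this have "Suc i \<in> positions w" using letters by simp
      ultimately show "Suc (Suc i) = length us" using * by simp
    qed auto
    moreover have "i < length us" if "Suc (Suc i) = length us" for i using that by simp
    ultimately show ?thesis by blast
  qed
  finally show ?thesis .
qed

lemma sat_in_state:
  assumes "us = vs @ [l]" "s VX = Position (length vs)"
  shows "sat PS PE w s (in_state E q) \<longleftrightarrow> state (map fst vs) = q"
proof (cases vs rule: rev_cases)
  case Nil
  have "sat PS PE w s (in_state E q) \<longleftrightarrow> q = 0"
    using assms Nil by (auto simp: in_state_def Ex_domain sat_penultimate)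
  then show ?thesis using Nil by auto
next
  case (snoc ws l')
  have i: "length ws \<in> positions w" "fst (letter_at w (length ws)) = code (fst l')"
    using letters[of "length ws"] assms(1) snoc by (auto simp: nth_append)
  have "fst l' \<in> set E" using edges assms(1) snoc by auto
  then have "sat PS PE w s (Ex VY (And (penultimate E VY) (has (filter (\<lambda>e. target e = q) E) VY)))
      \<longleftrightarrow> target (fst l') = q"
    using assms(1) snoc i by (auto simp: Ex_domain sat_penultimate)
  moreover have "\<exists>j. j \<in> positions w \<and> j < length vs" using i(1) snoc by auto
  ultimately show ?thesis
    using assms(2) snoc by (auto simp: in_state_def Ex_domain)
qed

lemma letter_eq: "i < length us \<Longrightarrow> us ! i = (e, p) \<longleftrightarrow> letter_at w i = (code e, p)"
  using letters[of i] by (cases "us ! i") auto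

lemma earlier_letter:
  assumes "k \<le> length us"
  shows "(\<exists>j<k. snd (letter_at w j) = p \<and> (\<exists>e\<in>set (filter P E). fst (letter_at w j) = code e)) \<longleftrightarrow>
    (\<exists>e. (e, p) \<in> set (take k us) \<and> P e)"
proof
  assume "\<exists>j<k. snd (letter_at w j) = p \<and> (\<exists>e\<in>set (filter P E). fst (letter_at w j) = code e)"
  then obtain j e where j: "j < k" "letter_at w j = (code e, p)" "P e" by (auto simp: prod_eq_iff)
  then have "us ! j = (e, p)" using letter_eq assms by simp
  then have "(e, p) \<in> set (take k us)"
    using j(1) assms by (auto simp: in_set_conv_nth intro!: exI[of _ j])
  then show "\<exists>e. (e, p) \<in> set (take k us) \<and> P e" using j(3) by blast
next
  assume "\<exists>e. (e, p) \<in> set (take k us) \<and> P e"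
  then obtain e j where j: "P e" "j < k" "us ! j = (e, p)"
    using assms by (auto simp: in_set_conv_nth)
  moreover have "e \<in> set E" using edge_nth[of j] j assms by simp
  moreover have "letter_at w j = (code e, p)" using letter_eq j assms by simp
  ultimately show "\<exists>j<k. snd (letter_at w j) = p \<and> (\<exists>e\<in>set (filter P E). fst (letter_at w j) = code e)"
    by auto
qed

lemma sat_play:
  assumes "us = vs @ [l]" "s VX = Position (length vs)"
  shows "sat PS PE w s (play E (instr (fst l))) \<longleftrightarrow> playable (instr (fst l)) (snd l) vs"
proof -
  let ?n = "length vs"
  have n: "?n \<in> positions w" "snd (letter_at w ?n) = snd l"
    using letters[of ?n] assms(1) by auto
  have below: "j \<in> positions w" if "j < length us" for j
    using letters that by blast
  have earlier: "(\<exists>j<?n. snd (letter_at w j) = p \<and> (\<exists>e\<in>set (filter P E). fst (letter_at w j) = code e))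
      \<longleftrightarrow> (\<exists>e. (e, p) \<in> set vs \<and> P e)" for p P
    using earlier_letter[of ?n p P] assms(1) by simp
  show ?thesis
  proof (cases "instr (fst l)")
    case (Inc r)
    have "sat PS PE w s (play E (Inc r)) \<longleftrightarrow> \<not> (\<exists>j<?n. snd (letter_at w j) = snd l)"
      using assms n below by (auto simp: Ex_domain)
    also have "\<dots> \<longleftrightarrow> snd l \<notin> snd ` set vs"
    proof -
      have "snd (letter_at w j) = snd (vs ! j)" if "j < ?n" for j
        using letters[of j] that assms(1) by (auto simp: nth_append)
      then have "(\<exists>j<?n. snd (letter_at w j) = snd l) \<longleftrightarrow> (\<exists>j<?n. snd (vs ! j) = snd l)" by auto
      also have "\<dots> \<longleftrightarrow> snd l \<in> set (map snd vs)" unfolding in_set_conv_nth by auto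
      finally show ?thesis by simp
    qed
    finally show ?thesis using Inc by simp
  next
    case (Dec r)
    have "sat PS PE w s (play E (Dec r)) \<longleftrightarrow>
        (\<exists>j<?n. snd (letter_at w j) = snd l \<and> (\<exists>e\<in>set (incs E r). fst (letter_at w j) = code e)) \<and>
        \<not> (\<exists>j<?n. snd (letter_at w j) = snd l \<and> (\<exists>e\<in>set (decs E). fst (letter_at w j) = code e))"
      using assms n below by (auto simp: Ex_domain)
    also have "\<dots> \<longleftrightarrow> snd l \<in> active r vs"
      unfolding incs_def decs_def earlier active_def by blast
    finally show ?thesis using Dec by simp
  next
    case (Test r)
    have later_same: "(\<exists>j<length us. snd (letter_at w j) = p \<and>
        (\<exists>e\<in>set (filter P E). fst (letter_at w j) = code e)) \<longleftrightarrow> (\<exists>e. (e, p) \<in> set us \<and> P e)" for p P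
      using earlier_letter[of "length us" p P] by simp
    have "sat PS PE w s (play E (Test r)) \<longleftrightarrow>
        (\<forall>i\<in>positions w. i < length us \<longrightarrow> (\<exists>e\<in>set (incs E r). fst (letter_at w i) = code e) \<longrightarrow>
          (\<exists>j\<in>positions w. j < length us \<and> snd (letter_at w j) = snd (letter_at w i) \<and>
            (\<exists>e\<in>set (decs E). fst (letter_at w j) = code e)))"
      by (auto simp: Ex_domain All_domain sat_before)
    also have "\<dots> \<longleftrightarrow>
        (\<forall>i<length us. (\<exists>e\<in>set (incs E r). fst (letter_at w i) = code e) \<longrightarrow>
          (\<exists>j<length us. snd (letter_at w j) = snd (letter_at w i) \<and>
            (\<exists>e\<in>set (decs E). fst (letter_at w j) = code e)))"
      using below by blast
    also have "\<dots> \<longleftrightarrow> (\<forall>p. (\<exists>i<length us. snd (letter_at w i) = p \<and>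
          (\<exists>e\<in>set (incs E r). fst (letter_at w i) = code e)) \<longrightarrow>
          (\<exists>j<length us. snd (letter_at w j) = p \<and> (\<exists>e\<in>set (decs E). fst (letter_at w j) = code e)))"
      by blast
    also have "\<dots> \<longleftrightarrow> active r us = {}"
      unfolding incs_def decs_def later_same active_def by blast
    \<comment> \<open>The formula ranges over all moves before the challenge and so includes the
      tested move itself. Being a test, that move neither increments nor decrements.\<close>
    also have "active r us = active r vs"
    proof -
      have "(e, p) \<in> set us \<and> instr e = Inc k \<longleftrightarrow> (e, p) \<in> set vs \<and> instr e = Inc k"
        "(e, p) \<in> set us \<and> instr e = Dec k \<longleftrightarrow> (e, p) \<in> set vs \<and> instr e = Dec k" for e p k
        using Test assms(1) by auto
      then show ?thesis by (simp only: active_def)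
    qed
    finally show ?thesis using Test by simp
  qed simp
qed

lemma sat_check_Nil: "us = [] \<Longrightarrow> sat PS PE w s (check E)"
  by (simp add: check_def sat_final)

text \<open>Only the last move before the challenge satisfies \<open>final\<close>, and its code
  singles out one disjunct of \<open>move\<close>; legality is what this disjunct expresses.\<close>

lemma sat_check_snoc:
  assumes "us = vs @ [l]"
  shows "sat PS PE w s (check E) \<longleftrightarrow> legal E vs l"
proof -
  let ?s = "s(VX := Position (length vs))"
  have n: "length vs \<in> positions w" "fst (letter_at w (length vs)) = code (fst l)"
    using letters[of "length vs"] assms by auto
  have "sat PS PE w s (check E) \<longleftrightarrow> sat PS PE w ?s (move E E)"
    using assms n(1) by (auto simp: check_def All_domain sat_final)
  also have "\<dots> \<longleftrightarrow> (\<exists>e\<in>set E. e = fst l \<and> sat PS PE w ?s (in_state E (source e)) \<and>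
      sat PS PE w ?s (play E (instr e)))"
  proof -
    have "sat PS PE w ?s (move E F) \<longleftrightarrow> (\<exists>e\<in>set F. e = fst l \<and>
      sat PS PE w ?s (in_state E (source e)) \<and> sat PS PE w ?s (play E (instr e)))" for F
      by (induction F) (use n(2) in auto)
    then show ?thesis .
  qed
  also have "\<dots> \<longleftrightarrow> legal E vs l"
  proof -
    have "sat PS PE w ?s (in_state E q) \<longleftrightarrow> state (map fst vs) = q" for q
      by (rule sat_in_state[OF assms]) simp
    moreover have "sat PS PE w ?s (play E (instr (fst l))) \<longleftrightarrow> playable (instr (fst l)) (snd l) vs"
      by (rule sat_play[OF assms]) simp
    ultimately show ?thesis unfolding legal_def by metis
  qed
  finally show ?thesis .
qed

end


section \<open>Plays\<close>

definition consistent :: "letter set \<Rightarrow> letter set \<Rightarrow> strategy \<Rightarrow> letter list \<Rightarrow> bool" where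
  "consistent \<Sigma>S \<Sigma> \<S> u \<longleftrightarrow> u \<in> lists \<Sigma> \<and> (\<forall>i<length u. u ! i \<in> \<Sigma>S \<longrightarrow> \<S> (take i u) = Some (u ! i))"

lemma consistent_snoc:
  "consistent \<Sigma>S \<Sigma> \<S> (u @ [l]) \<longleftrightarrow> consistent \<Sigma>S \<Sigma> \<S> u \<and> l \<in> \<Sigma> \<and> (l \<in> \<Sigma>S \<longrightarrow> \<S> u = Some l)"
  by (auto simp: consistent_def less_Suc_eq nth_append)

lemma length_prefix_of [simp]: "length (prefix_of w n) = n"
  by (simp add: prefix_of_def)

lemma nth_prefix_of [simp]: "i < n \<Longrightarrow> prefix_of w n ! i = letter_at w i"
  by (simp add: prefix_of_def)

lemma set_prefix_of: "set (prefix_of w n) = letter_at w ` {..<n}"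
  by (simp add: prefix_of_def atLeast0LessThan)

lemma take_prefix_of: "i \<le> n \<Longrightarrow> take i (prefix_of w n) = prefix_of w i"
  by (simp add: prefix_of_def take_map)

lemma prefix_of_Fin: "i \<le> length u \<Longrightarrow> prefix_of (Fin u) i = take i u"
  by (rule nth_equalityI) auto

primrec follow :: "strategy \<Rightarrow> letter list \<Rightarrow> nat \<Rightarrow> letter list" where
  "follow \<S> v 0 = v"
| "follow \<S> v (Suc k) = (case \<S> (follow \<S> v k) of None \<Rightarrow> follow \<S> v k | Some l \<Rightarrow> follow \<S> v k @ [l])"

lemma follow_length:
  "\<forall>j<k. \<S> (follow \<S> v j) \<noteq> None \<Longrightarrow> length (follow \<S> v k) = length v + k"
  by (induction k) (auto simp: less_Suc_eq)

lemma follow_prefix: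
  assumes "\<forall>j<k. \<S> (follow \<S> v j) \<noteq> None" "j \<le> k"
  shows "take (length v + j) (follow \<S> v k) = follow \<S> v j"
  using assms
proof (induction k)
  case (Suc k)
  show ?case
  proof (cases "j = Suc k")
    case True
    then show ?thesis using follow_length[of "Suc k" \<S> v] Suc.prems(1) by simp
  next
    case False
    then have "j \<le> k" using Suc.prems(2) by simp
    moreover have "length (follow \<S> v k) = length v + k"
      using Suc.prems(1) by (intro follow_length) auto
    ultimately show ?thesis using Suc.IH Suc.prems(1) by (auto split: option.split)
  qed
qed simp

context
  fixes \<Sigma>S \<Sigma>E :: "letter set" and \<S> :: strategy and v :: "letter list"
  assumes strategy: "is_strategy \<Sigma>S \<Sigma>E \<S>" and v: "consistent \<Sigma>S (\<Sigma>S \<union> \<Sigma>E) \<S> v"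
begin

lemma follow_consistent: "consistent \<Sigma>S (\<Sigma>S \<union> \<Sigma>E) \<S> (follow \<S> v k)"
proof (induction k)
  case (Suc k)
  then have "l \<in> \<Sigma>S" if "\<S> (follow \<S> v k) = Some l" for l
    using strategy that unfolding is_strategy_def consistent_def by blast
  then show ?case using Suc by (auto simp: consistent_snoc split: option.split)
qed (simp add: v)

lemma follow_letter:
  assumes "\<forall>j<k. \<S> (follow \<S> v j) \<noteq> None" "length v \<le> i" "i < length v + k"
  shows "follow \<S> v k ! i \<in> \<Sigma>S"
proof -
  obtain j where j: "i = length v + j" "j < k" using assms(2,3) by (metis add_less_cancel_left le_Suc_ex)
  obtain l where l: "\<S> (follow \<S> v j) = Some l" using assms(1) j(2) by blast
  have "take (length v + Suc j) (follow \<S> v k) = follow \<S> v j @ [l]"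
    using follow_prefix[OF assms(1), of "Suc j"] j(2) l by simp
  moreover have "follow \<S> v k ! i = take (length v + Suc j) (follow \<S> v k) ! i"
    using j(1) by simp
  moreover have "length (follow \<S> v j) = i"
    using follow_length[of j \<S> v] assms(1) j by simp
  ultimately have "follow \<S> v k ! i = l" by (metis nth_append_length)
  moreover have "l \<in> \<Sigma>S"
    using strategy l follow_consistent[of j] unfolding is_strategy_def consistent_def by blast
  ultimately show ?thesis by simp
qed

text \<open>After \<open>v\<close>, Environment stays idle.\<close>

lemma play_exists:
  "\<exists>w. dword_over (\<Sigma>S \<union> \<Sigma>E) w \<and> compatible \<Sigma>S \<S> w \<and> fair \<Sigma>S \<S> w \<and>
    (\<forall>i<length v. i \<in> positions w \<and> letter_at w i = v ! i) \<and>
    (\<forall>i\<in>positions w. length v \<le> i \<longrightarrow> letter_at w i \<in> \<Sigma>S)"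
proof (cases "\<exists>k. \<S> (follow \<S> v k) = None")
  case True
  \<comment> \<open>The play ends when the strategy first falls silent. A finite word has finitely
    many prefixes, so fairness holds vacuously.\<close>
  define k where "k = (LEAST k. \<S> (follow \<S> v k) = None)"
  have None: "\<S> (follow \<S> v k) = None" using True unfolding k_def by (rule LeastI_ex)
  have Some: "\<forall>j<k. \<S> (follow \<S> v j) \<noteq> None"
    using not_less_Least unfolding k_def by blast
  let ?u = "follow \<S> v k"
  have len: "length ?u = length v + k" using Some by (rule follow_length)
  have "take (length v) ?u = v" using follow_prefix[OF Some, of 0] by simp
  then have "?u ! i = v ! i" if "i < length v" for i
    using that by (metis nth_take)
  moreover have "?u ! i \<in> \<Sigma>S" if "i < length ?u" "length v \<le> i" for i
    using follow_letter[OF Some that(2)] that(1) len by simp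
  moreover have "compatible \<Sigma>S \<S> (Fin ?u)"
    using follow_consistent[of k] None by (auto simp: compatible_def consistent_def prefix_of_Fin)
  moreover have "dword_over (\<Sigma>S \<union> \<Sigma>E) (Fin ?u)"
    using follow_consistent[of k] by (auto simp: dword_over_def consistent_def)
  moreover have "fair \<Sigma>S \<S> (Fin ?u)"
    by (simp add: fair_def)
  ultimately show ?thesis using len by (intro exI[of _ "Fin ?u"]) simp
next
  case False
  then have Some: "\<forall>j<k. \<S> (follow \<S> v j) \<noteq> None" for k by auto
  \<comment> \<open>The limit of the growing prefixes. Stage \<open>Suc i\<close> has length
    \<open>length v + Suc i\<close> and so contains index \<open>i\<close>, even for empty
    \<open>v\<close>.\<close>
  let ?f = "\<lambda>i. follow \<S> v (Suc i) ! i"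
  have len: "length (follow \<S> v k) = length v + k" for k using Some by (rule follow_length)
  have nth: "?f i = follow \<S> v k ! i" if "i < length v + k" for i k
  proof -
    have "follow \<S> v (max k (Suc i)) ! i = follow \<S> v j ! i" if "i < length v + j" "j \<le> max k (Suc i)" for j
      using follow_prefix[OF Some that(2)] that(1) by (metis nth_take)
    from this[of k] this[of "Suc i"] show ?thesis using that by simp
  qed
  have f: "?f i \<in> \<Sigma>S \<union> \<Sigma>E" "?f i \<in> \<Sigma>S \<longrightarrow> \<S> (prefix_of (Inf ?f) i) = Some (?f i)" for i
  proof -
    have "take i (follow \<S> v (Suc i)) = prefix_of (Inf ?f) i"
    proof (rule nth_equalityI)
      fix j assume "j < length (take i (follow \<S> v (Suc i)))"
      then have "j < i" by simp
      then show "take i (follow \<S> v (Suc i)) ! j = prefix_of (Inf ?f) i ! j"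
        using nth[of j "Suc i"] by (simp del: follow.simps)
    qed (simp add: len del: follow.simps)
    moreover have "i < length (follow \<S> v (Suc i))" by (simp only: len)
    ultimately show "?f i \<in> \<Sigma>S \<union> \<Sigma>E" "?f i \<in> \<Sigma>S \<longrightarrow> \<S> (prefix_of (Inf ?f) i) = Some (?f i)"
      using follow_consistent[of "Suc i"] unfolding consistent_def by (metis in_listsD nth_mem)+
  qed
  have "?f i \<in> \<Sigma>S" if "length v \<le> i" for i
    using follow_letter[OF Some that, of "Suc i"] by simp
  moreover have "?f i = v ! i" if "i < length v" for i
    using nth[of i 0] that by simp
  moreover have "compatible \<Sigma>S \<S> (Inf ?f)" "dword_over (\<Sigma>S \<union> \<Sigma>E) (Inf ?f)"
    using f by (auto simp: compatible_def dword_over_def)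
  moreover have "fair \<Sigma>S \<S> (Inf ?f)"
  proof -
    have "{length v..} \<subseteq> {i. ?f i \<in> \<Sigma>S}" using calculation(1) by auto
    then have "infinite {i. ?f i \<in> \<Sigma>S}" using infinite_Ici infinite_super by blast
    then show ?thesis by (simp add: fair_def)
  qed
  ultimately show ?thesis by (intro exI[of _ "Inf ?f"]) simp
qed

end


section \<open>Correctness of the reduction\<close>

definition alphabet :: "edge list \<Rightarrow> action set" where
  "alphabet E = code ` set E"

lemma zero_not_in_alphabet [simp]: "0 \<notin> alphabet E"
  by (auto simp: alphabet_def)

lemma models_spec_input:
  "models PS PE w (And (spec E) (on_input x y)) \<longleftrightarrow>
    PE \<noteq> {} \<and> (\<forall>s. sat PS PE w s (check E)) \<and>
    ((\<exists>i\<in>positions w. fst (letter_at w i) = 0) \<or>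
     (\<exists>i\<in>positions w. \<exists>e\<in>set E. target e = 3 \<and> fst (letter_at w i) = code e)) \<and>
    (\<forall>i\<in>positions w. \<forall>e. fst (letter_at w i) = code e \<longrightarrow> timely x y i e)"
  by (auto simp: models_def spec_def sat_on_input Ex_domain image_iff)

lemma valid_if_partsynth:
  assumes "partsynth (alphabet E, {0}, And (spec E) (on_input x y))"
  shows "\<exists>us. valid E x y us \<and> state (map fst us) = 3"
proof -
  obtain PS PE \<S> where disjoint: "PS \<inter> PE = {}"
    and strategy: "is_strategy (alphabet E \<times> PS) ({0} \<times> PE) \<S>"
    and win: "winning (alphabet E) {0} PS PE \<S> (And (spec E) (on_input x y))"
    using assms by auto
  let ?\<Sigma>S = "alphabet E \<times> PS" and ?\<Sigma>E = "{0} \<times> PE"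
  have play: "\<exists>w. models PS PE w (And (spec E) (on_input x y)) \<and> dword_over (?\<Sigma>S \<union> ?\<Sigma>E) w \<and>
      compatible ?\<Sigma>S \<S> w \<and> (\<forall>i<length v. i \<in> positions w \<and> letter_at w i = v ! i) \<and>
      (\<forall>i\<in>positions w. length v \<le> i \<longrightarrow> letter_at w i \<in> ?\<Sigma>S)"
    if "consistent ?\<Sigma>S (?\<Sigma>S \<union> ?\<Sigma>E) \<S> v" for v
    using play_exists[OF strategy that] win unfolding winning_def by blast
  have "consistent ?\<Sigma>S (?\<Sigma>S \<union> ?\<Sigma>E) \<S> []" by (simp add: consistent_def)
  from play[OF this] obtain w where w: "models PS PE w (And (spec E) (on_input x y))"
    "compatible ?\<Sigma>S \<S> w" "\<forall>i\<in>positions w. letter_at w i \<in> ?\<Sigma>S" by auto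
  \<comment> \<open>In the play without challenges only the accepting disjunct of the specification
    remains.\<close>
  have "fst (letter_at w i) \<noteq> 0" if "i \<in> positions w" for i
    using w(3) that by (metis mem_Times_iff zero_not_in_alphabet)
  then obtain n e where n: "n \<in> positions w" "fst (letter_at w n) = code e" "target e = 3"
    using w(1) unfolding models_spec_input by blast
  obtain q where q: "q \<in> PE" using w(1) unfolding models_spec_input by blast
  have "\<exists>l. fst l \<in> set E \<and> letter_at w i = map_prod code id l" if "i \<le> n" for i
  proof -
    have "letter_at w i \<in> ?\<Sigma>S" using w(3) positions_downward[OF n(1) that] by blast
    then obtain e q where "e \<in> set E" "letter_at w i = (code e, q)" by (auto simp: alphabet_def)
    then show ?thesis by (intro exI[of _ "(e, q)"]) simp
  qed
  then obtain l where l: "\<And>i. i \<le> n \<Longrightarrow> fst (l i) \<in> set E"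
    "\<And>i. i \<le> n \<Longrightarrow> letter_at w i = map_prod code id (l i)" by metis
  define us where "us = map l [0..<Suc n]"
  have len: "length us = Suc n" by (simp add: us_def)
  have nth: "us ! i = l i" if "i \<le> n" for i using that by (simp add: us_def del: upt_Suc)
  have "valid E x y us"
  proof (rule valid_if_take)
    fix k assume k: "k < length us"
    \<comment> \<open>Branching off by a challenge right after move \<open>k\<close> makes this move
      the final one of the new word, so \<open>check\<close> there speaks about a move that is
      shared with \<open>w\<close>.\<close>
    let ?v = "prefix_of w (Suc k) @ [(0, q)]"
    have below: "i \<in> positions w" if "i \<le> k" for i
      using positions_downward[OF n(1)] that k len by simp
    have "consistent ?\<Sigma>S (?\<Sigma>S \<union> ?\<Sigma>E) \<S> (prefix_of w (Suc k))"
    proof -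
      have "letter_at w j \<in> ?\<Sigma>S" "\<S> (prefix_of w j) = Some (letter_at w j)" if "j \<le> k" for j
        using below[OF that] w(2,3) by (simp_all add: compatible_def)
      moreover from this(1) have "set (prefix_of w (Suc k)) \<subseteq> ?\<Sigma>S"
        unfolding set_prefix_of lessThan_Suc_atMost by blast
      ultimately show ?thesis
        unfolding consistent_def in_lists_conv_set by (auto simp: take_prefix_of less_Suc_eq_le)
    qed
    then have "consistent ?\<Sigma>S (?\<Sigma>S \<union> ?\<Sigma>E) \<S> ?v"
      using q by (simp add: consistent_snoc)
    from play[OF this] obtain w' where w': "models PS PE w' (And (spec E) (on_input x y))"
      "\<forall>i<length ?v. i \<in> positions w' \<and> letter_at w' i = ?v ! i" by blast
    have "letter_at w' i = map_prod code id (us ! i)" "i \<in> positions w'" if "i \<le> k" for i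
      using w'(2)[rule_format, of i] that l(2)[of i] nth[of i] k len by (auto simp: nth_append)
    moreover have "fst (letter_at w' (Suc k)) = 0"
      using w'(2)[rule_format, of "Suc k"] by (simp add: nth_append)
    moreover have "fst ` set (take (Suc k) us) \<subseteq> set E"
    proof -
      have "fst ` set us = (\<lambda>i. fst (l i)) ` {..<Suc n}"
        by (simp add: us_def image_image atLeast0LessThan del: upt_Suc)
      also have "\<dots> \<subseteq> set E" using l(1) by (auto simp del: lessThan_Suc)
      finally show ?thesis using set_take_subset[of "Suc k" us] by blast
    qed
    moreover have "length (take (Suc k) us) = Suc k" using k by simp
    ultimately interpret challenged_word E "take (Suc k) us" w' PS PE
      by unfold_locales auto
    have "take (Suc k) us = take k us @ [us ! k]" using k by (rule take_Suc_conv_app_nth)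
    from sat_check_snoc[OF this] have "legal E (take k us) (us ! k)"
      using w'(1) unfolding models_spec_input by blast
    moreover have "timely x y k (fst (us ! k))"
    proof -
      have "k \<in> positions w'" "fst (letter_at w' k) = code (fst (us ! k))"
        using letters[of k] k by auto
      then show ?thesis using w'(1) unfolding models_spec_input by blast
    qed
    ultimately show "legal E (take k us) (us ! k) \<and> timely x y k (fst (us ! k))" ..
  qed
  moreover have "state (map fst us) = 3"
  proof -
    have "fst (l n) = e" using l(2)[of n] n(2) by auto
    then show ?thesis using n(3) by (simp add: us_def)
  qed
  ultimately show ?thesis by blast
qed

text \<open>System replays one fixed accepting word and falls silent at any deviation. Whenever the
  first challenge comes, the moves before it form a prefix of this word, and prefixes end in a legal
  move.\<close>

lemma partsynth_if_valid:
  assumes us: "valid E x y us" "state (map fst us) = 3"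
  shows "partsynth (alphabet E, {0}, And (spec E) (on_input x y))"
proof -
  define PS where "PS = snd ` set us"
  obtain q where q: "q \<notin> PS" using ex_new_if_finite[of PS] by (auto simp: PS_def)
  define u where "u = map (map_prod code id) us"
  define \<S> where "\<S> v = (if length v < length u \<and> v = take (length v) u
    then Some (u ! length v) else None)" for v
  let ?\<Sigma>S = "alphabet E \<times> PS" and ?\<Sigma>E = "{0} \<times> {q}"
  have len: "length u = length us" by (simp add: u_def)
  have nth_E: "fst (us ! i) \<in> set E" if "i < length us" for i
    using valid_take[OF us(1) that] by (simp add: legal_def)
  then have E: "fst ` set us \<subseteq> set E" by (metis image_subsetI in_set_conv_nth)
  have u: "u ! i \<in> ?\<Sigma>S" "u ! i = map_prod code id (us ! i)" if "i < length us" for i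
  proof -
    have "us ! i \<in> set us" using that by simp
    then show "u ! i \<in> ?\<Sigma>S" "u ! i = map_prod code id (us ! i)"
      using that nth_E[OF that] by (auto simp: u_def PS_def alphabet_def mem_Times_iff)
  qed
  have "is_strategy ?\<Sigma>S ?\<Sigma>E \<S>"
    using u(1) by (auto simp: is_strategy_def \<S>_def len split: if_splits simp del: mem_Sigma_iff)
  moreover have "models PS {q} w (And (spec E) (on_input x y))"
    if over: "dword_over (?\<Sigma>S \<union> ?\<Sigma>E) w" and comp: "compatible ?\<Sigma>S \<S> w" for w
  proof -
    have system: "i < length us \<and> prefix_of w i = take i u \<and> letter_at w i = u ! i"
      if "i \<in> positions w" "fst (letter_at w i) \<noteq> 0" for i
    proof -
      have "letter_at w i \<in> ?\<Sigma>S" using over that by (auto simp: dword_over_def)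
      then have "\<S> (prefix_of w i) = Some (letter_at w i)"
        using comp that by (simp add: compatible_def)
      then show ?thesis by (auto simp: \<S>_def len split: if_splits)
    qed
    let ?stop = "\<lambda>i. i \<notin> positions w \<or> fst (letter_at w i) = 0"
    \<comment> \<open>The first challenge or, if there is none, the end of the word.\<close>
    define k where "k = (LEAST i. ?stop i)"
    have stop: "?stop (length us)" using system by blast
    have k: "k \<le> length us" "?stop k"
      unfolding k_def by (rule Least_le LeastI[where P = ?stop], rule stop)+
    have below: "i \<in> positions w" "letter_at w i = map_prod code id (us ! i)" if "i < k" for i
      using not_less_Least[of i ?stop] that system[of i] u(2)[of i] by (auto simp: k_def)
    have "length (take k us) = k" using k by simp
    moreover have "fst ` set (take k us) \<subseteq> set E" using E set_take_subset[of k us] by blast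
    ultimately interpret challenged_word E "take k us" w PS "{q}"
      using below k by unfold_locales auto
    have "sat PS {q} w s (check E)" for s
    proof (cases k)
      case 0
      then show ?thesis by (intro sat_check_Nil) simp
    next
      case (Suc j)
      then have "take k us = take j us @ [us ! j]" "legal E (take j us) (us ! j)"
        using k(1) valid_take[OF us(1), of j] by (simp_all add: take_Suc_conv_app_nth)
      then show ?thesis by (simp add: sat_check_snoc)
    qed
    moreover have "(\<exists>i\<in>positions w. fst (letter_at w i) = 0) \<or>
     (\<exists>i\<in>positions w. \<exists>e\<in>set E. target e = 3 \<and> fst (letter_at w i) = code e)"
    proof (cases "k \<in> positions w")
      case True
      then show ?thesis using k(2) by blast
    next
      case False
      then obtain v where v: "w = Fin v" "length v \<le> k" by (cases w) auto
      then have lv: "length v = k" using below(1) by (metis le_neq_implies_less less_irrefl lessThan_iff positions.simps(1))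
      have "v = take k u"
        by (rule nth_equalityI) (use lv k len below(2) v u(2) in auto)
      \<comment> \<open>A compatible finite word ends only where the strategy is silent. On a proper
        prefix of \<open>u\<close> it is not, so the whole accepting run has been played.\<close>
      moreover have "\<S> v = None" using comp v(1) by (simp add: compatible_def)
      ultimately have kl: "k = length us" using k(1) lv len by (auto simp: \<S>_def split: if_splits)
      have "us \<noteq> []" using us(2) by auto
      then have i: "k - 1 < k" "fst (us ! (k - 1)) \<in> set E" "target (fst (us ! (k - 1))) = 3"
        using us(2) kl E by (auto simp: state_def last_conv_nth)
      have "k - 1 \<in> positions w" "fst (letter_at w (k - 1)) = code (fst (us ! (k - 1)))"
        using below[OF i(1)] by simp_all
      then show ?thesis using i(2,3) by blast
    qed
    moreover have "timely x y i e" if "i \<in> positions w" "fst (letter_at w i) = code e" for i e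
    proof -
      have i: "i < length us" "letter_at w i = u ! i" using system[of i] that by auto
      then have "e = fst (us ! i)" using u(2) that(2) by simp
      then show ?thesis using valid_take[OF us(1) i(1)] by simp
    qed
    ultimately show ?thesis unfolding models_spec_input by blast
  qed
  ultimately show ?thesis
    using q unfolding partsynth.simps winning_def
    by - (rule exI[of _ PS], rule exI[of _ "{q}"], auto simp: PS_def)
qed

lemma partsynth_iff:
  "partsynth (alphabet (automaton p), {0}, And (spec (automaton p)) (on_input x y)) \<longleftrightarrow>
    (\<exists>\<sigma>. sem p (input x y) \<sigma>)"
  using valid_if_partsynth partsynth_if_valid accepting_run_iff by blast

section \<open>Computing the code of the instance, and the diagonal argument\<close>

lemma computable_later:
  assumes "computable n h"
  shows "computable n (\<lambda>xs. form_encode (later (h xs)))"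
proof -
  let ?less = "form_encode (Less VY VX)" and ?eq = "form_encode (Eq VX VY)"
  \<comment> \<open>One unfolding of \<open>later\<close> on codes: 10 and 8 are the tags of
    \<open>Ex\<close> and \<open>And\<close>, 1 and 0 the codes of \<open>VY\<close> and
    \<open>VX\<close>, and \<open>ys ! 1\<close> is the code from the previous stage.\<close>
  let ?b = "\<lambda>ys. prod_encode (10, prod_encode (1, prod_encode (8, prod_encode (?less,
    prod_encode (10, prod_encode (0, prod_encode (8, prod_encode (?eq, ys ! 1))))))))"
  have "computable (Suc 0)
      (\<lambda>xs. rec_nat (form_encode (later 0)) (\<lambda>k y. ?b (k # y # tl xs)) (hd xs))"
    by (rule computable_rec_nat) (intro computable_prod_encode computable_const computable_proj; simp)+
  moreover have "rec_nat (form_encode (later 0)) (\<lambda>k y. ?b (k # y # cs)) m = form_encode (later m)"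
    for m and cs :: "nat list"
    by (induction m) (simp_all del: later.simps(1))
  ultimately have "computable 1 (\<lambda>xs. form_encode (later (hd xs)))" by simp
  from computable_comp1[OF this assms] show ?thesis by simp
qed

lemma computable_on_input:
  assumes "computable n a" "computable n b"
  shows "computable n (\<lambda>xs. form_encode (on_input (a xs) (b xs)))"
  unfolding on_input_def at_time_def form_encode.simps var_encode.simps
  by (intro computable_prod_encode computable_const computable_later computable_add computable_Suc
      assms)

theorem theorem3:
  "\<not> decidable_problem partsynth_instances inst_encode partsynth"
proof
  assume "decidable_problem partsynth_instances inst_encode partsynth"
  then obtain f where
    f: "rec_eval f [inst_encode i] (if partsynth i then 1 else 0)" if "i \<in> partsynth_instances" for i
    unfolding decidable_problem_def by blast
  \<comment> \<open>The two arguments stand for the codes of the alphabet and of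
    \<open>spec E\<close>; 1 is the code of the Environment alphabet \<open>{0}\<close> and 8 the
    tag of \<open>And\<close>.\<close>
  define enc where "enc xs = prod_encode (xs ! 0, prod_encode (1, prod_encode (8,
    prod_encode (xs ! 1, form_encode (on_input (xs ! 0) (xs ! 1))))))" for xs
  have "computable 2 enc"
    unfolding enc_def by (intro computable_prod_encode computable_const computable_on_input
      computable_proj) simp_all
  then obtain g where "\<forall>xs. length xs = 2 \<longrightarrow> rec_eval g xs (enc xs)"
    unfolding computable_def by blast
  then have g: "rec_eval g [x, y] (enc [x, y])" for x y by simp
  define h where "h = Comp f [g]"
  \<comment> \<open>The answer for the input in registers 0 and 1 goes to register 2, and the test
    lets an execution finish only for the answer 0, that is, "no".\<close>
  define p where "p = Seq (compile h [0, 1] 2 3) (Op (Test 2))"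
  define E where "E = automaton p"
  \<comment> \<open>\<open>E\<close> is already fixed here and does not mention \<open>x\<close> or
    \<open>y\<close>, so the self-reference is an ordinary definition.\<close>
  define x where "x = set_encode (alphabet E)"
  define y where "y = form_encode (spec E)"
  define i where "i = (alphabet E, {0::nat}, And (spec E) (on_input x y))"
  have "start0 \<in> set E" "start1 \<in> set E" by (simp_all add: E_def automaton_def)
  then have "i \<in> partsynth_instances"
    using actions_spec[of E] free_vars_spec
    by (auto simp: i_def partsynth_instances_def alphabet_def free_vars_on_input actions_on_input)
  moreover have "inst_encode i = enc [x, y]"
    by (simp add: i_def enc_def x_def y_def set_encode_def)
  ultimately have "rec_eval f [enc [x, y]] (if partsynth i then 1 else 0)" using f by metis
  then have eval: "rec_eval h [x, y] (if partsynth i then 1 else 0)"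
    using g by (auto simp: h_def intro!: exI[of _ "[_]"])
  have "partsynth i \<longleftrightarrow> (\<exists>\<sigma>. sem p (input x y) \<sigma>)"
    unfolding i_def E_def by (rule partsynth_iff)
  also have "\<dots> \<longleftrightarrow> rec_eval h [x, y] 0"
  proof -
    have "sem (compile h [0, 1] 2 3) (input x y) \<sigma> \<longleftrightarrow>
        (\<exists>z. rec_eval h (map (input x y) [0, 1]) z \<and> \<sigma> = (input x y)(2 := z))" for \<sigma>
      by (rule compilesD[OF compiles]) auto
    moreover have "map (input x y) [0, 1] = [x, y]" by simp
    ultimately have "sem (compile h [0, 1] 2 3) (input x y) \<sigma> \<longleftrightarrow>
        (\<exists>z. rec_eval h [x, y] z \<and> \<sigma> = (input x y)(2 := z))" for \<sigma> by (simp only:)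
    then show ?thesis unfolding p_def sem_Seq sem.simps(1) op_step.simps by auto
  qed
  also have "\<dots> \<longleftrightarrow> \<not> partsynth i"
    \<comment> \<open>The procedure has a value on this instance; being unique, that value is 0
      exactly if the instance has the answer "no".\<close>
    using eval rec_eval_deterministic[OF eval, of 0] by (auto split: if_splits)
  finally show False by simp
qed

end
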